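(* Let $(P)$ be the problem in the context. Suppose that Assumption (D) (bounded domains), Assumption (S) (structure) and the constraint qualification $\mathbf{CQ}$ from the context hold. Let $(x^*,y^* )$ be a solution to $(P)$ and let $\{(x^t,y^t)\}$ be generated by the algorithm in the context. (Case 1) If $\min\{\mu,\nu\}\ge 0.5$ and $\delta=0.5$ is chosen in the algorithm, then $$\left|f(x^t)+g(y^t)-f(x^* )-g(y^* )\right|=\mathcal{O}\left((t+1)^{-1/2}\right),\qquad\|Ax^t+By^t-c\|=\mathcal{O}\left((t+1)^{-1/2}\right).$$ (Case 2) If $\min\{\mu,\nu\}<0.5$ and $\delta=1-\min\{\mu,\nu\}$ is chosen in the algorithm, then $$\left|f(x^t)+g(y^t)-f(x^* )-g(y^* )\right|=\mathcal{O}\left((t+1)^{-\min\{\mu,\nu\}}\right),\qquad\|Ax^t+By^t-c\|=\mathcal{O}\left((t+1)^{-1/2}\right).$$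
   Context: Problem $(P)$: $\min_{x\in\mathcal{E}_1,y\in\mathcal{E}_2} f(x)+g(y)$ subject to $Ax+By=c$, where $\mathcal{E},\mathcal{E}_1,\mathcal{E}_2$ are finite dimensional (real) Hilbert spaces, $c\in\mathcal{E}$, $A:\mathcal{E}_1\to\mathcal{E}$ and $B:\mathcal{E}_2\to\mathcal{E}$ are linear, $f:\mathcal{E}_1\to(-\infty,\infty]$ and $g:\mathcal{E}_2\to(-\infty,\infty]$ are proper closed convex, and the solution set is nonempty. $A^*$ is the adjoint, $\lambda_{\max}$ the largest eigenvalue, $\operatorname{dom}$ the effective domain, $\mathrm{ri}$ the relative interior. Big-$\mathcal{O}$ is as $t\to\infty$, with constants independent of $t$. $\mathbf{CQ}$: $c\in A\,\mathrm{ri}(\operatorname{dom}f)+B\,\mathrm{ri}(\operatorname{dom}g)$. Assumption (D): $D_f:=\sup_{x_1,x_2\in\operatorname{dom}f}\|x_1-x_2\|<\infty$ and $D_g:=\sup_{y_1,y_2\in\operatorname{dom}g}\|y_1-y_2\|<\infty$. Assumption (S): $f=f_1+f_2$, $g=g_1+g_2$ with $f_1:\mathcal{E}_1\to\mathbb{R}$, $g_1:\mathcal{E}_2\to\mathbb{R}$ convex and smooth, $f_2:\mathcal{E}_1\to(-\infty,\infty]$, $g_2:\mathcal{E}_2\to(-\infty,\infty]$ proper closed convex; $\nabla f_1$ and $\nabla g_1$ are Hölder continuous on $\operatorname{dom}f$ and $\operatorname{dom}g$ respectively, and $\mu,\nu\in(0,1]$, $M_f,M_g\ge0$ are constants such that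 $f_1(y)\le f_1(x)+\langle\nabla f_1(x),y-x\rangle+\frac{M_f}{\mu+1}\|y-x\|^{\mu+1}$ for all $x,y\in\operatorname{dom}f$, and $g_1(y)\le g_1(x)+\langle\nabla g_1(x),y-x\rangle+\frac{M_g}{\nu+1}\|y-x\|^{\nu+1}$ for all $x,y\in\operatorname{dom}g$; and for every $v\in\mathcal{E}_2$ a minimizer of $y\mapsto\langle v,y\rangle+g_2(y)$ over $\mathcal{E}_2$ exists. (The paper also assumes that these minimizers and the proximal mappings of $\gamma f_2$, $\gamma>0$, can be computed efficiently.) Algorithm: choose $x^0\in\operatorname{dom}f$, $y^0\in\operatorname{dom}g$, $\beta_0>0$, $H_0>0$, $\delta\in(0,1)$; let $\lambda_A=\lambda_{\max}(A^*A)$. For $t=0,1,\dots$, with $\alpha_t=\frac{2}{t+2}$: $R^t=Ax^t+By^t-c$; $x^{t+1}=\arg\min_{x}\ \langle\nabla f_1(x^t)+\beta_tA^*R^t,x-x^t\rangle+\frac{H_t+\lambda_A\beta_t}{2}\|x-x^t\|^2+f_2(x)$; $\widetilde R^t=Ax^{t+1}+By^t-c$; $u^t\in\operatorname{Argmin}_{y}\ \langle\nabla g_1(y^t)+\beta_tB^*\widetilde R^t,y\rangle+g_2(y)$ (any minimizer); $y^{t+1}=y^t+\alpha_t(u^t-y^t)$; $H_{t+1}=\max\{H_0,\frac{2M_f}{\mu+1}\}(t+1)^{1-\mu}$, $\beta_{t+1}=\beta_0(t+2)^{\delta}$ (so $\beta_t=\beta_0(t+1)^\delta$ for all $t\ge0$).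 *)

theory Defs
  imports "HOL-Analysis.Analysis" "HOL-Library.Landau_Symbols"
begin

definition edom :: "('a \<Rightarrow> ereal) \<Rightarrow> 'a set" where
  "edom f = {x. f x < \<infinity>}"

(* The library's constant epigraph is restricted to real-valued functions. *)
definition epi :: "('a \<Rightarrow> ereal) \<Rightarrow> ('a \<times> real) set" where
  "epi f = {(x, r). f x \<le> ereal r}"

definition proper_closed_convex :: "('a::euclidean_space \<Rightarrow> ereal) \<Rightarrow> bool" where
  "proper_closed_convex f \<longleftrightarrow>
     (\<forall>x. f x \<noteq> -\<infinity>) \<and> edom f \<noteq> {} \<and> closed (epi f) \<and> convex (epi f)"

(* Supremum in the extended reals, so that an unbounded domain has diameter \<infinity>
   (the library's diameter is real-valued and is meaningful for bounded sets only). *)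
definition dom_diameter :: "('a::real_normed_vector \<Rightarrow> ereal) \<Rightarrow> ereal" where
  "dom_diameter f = (SUP (x1, x2) \<in> edom f \<times> edom f. ereal (norm (x1 - x2)))"

definition is_eigenvalue :: "('a::real_vector \<Rightarrow> 'a) \<Rightarrow> real \<Rightarrow> bool" where
  "is_eigenvalue T l \<longleftrightarrow> (\<exists>v. v \<noteq> 0 \<and> T v = l *\<^sub>R v)"

definition lambda_max :: "('a::real_vector \<Rightarrow> 'a) \<Rightarrow> real" where
  "lambda_max T = (GREATEST l. is_eigenvalue T l)"

definition hoelder_continuous_on ::
    "'a::real_normed_vector set \<Rightarrow> ('a \<Rightarrow> 'b::real_normed_vector) \<Rightarrow> bool" where
  "hoelder_continuous_on S F \<longleftrightarrow>
     (\<exists>p L. 0 < p \<and> p \<le> 1 \<and> 0 \<le> L \<and>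
        (\<forall>x\<in>S. \<forall>y\<in>S. norm (F x - F y) \<le> L * norm (x - y) powr p))"

(* (P): minimise f x + g y subject to A x + B y = c. *)
definition is_solution ::
    "('a \<Rightarrow> ereal) \<Rightarrow> ('b \<Rightarrow> ereal) \<Rightarrow> ('a \<Rightarrow> 'c::plus) \<Rightarrow> ('b \<Rightarrow> 'c) \<Rightarrow> 'c \<Rightarrow> 'a \<times> 'b \<Rightarrow> bool" where
  "is_solution f g A B c = is_arg_min (\<lambda>(x, y). f x + g y) (\<lambda>(x, y). A x + B y = c)"

end

theory Submission
  imports Defs
begin

text \<open>
  Compare one iteration with the point \<open>x\<^sup>t + \<alpha>\<^sub>t (x\<^sup>* - x\<^sup>t)\<close>. The strong convexity of the proximal
  subproblem leaves a quadratic term that absorbs the coupling \<open>\<langle>A(x\<^sup>t\<^sup>+\<^sup>1 - x\<^sup>t), B(y\<^sup>* - y\<^sup>t)\<rangle>\<close>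
  of the two blocks, so with \<open>E\<^sub>t = f(x\<^sup>t) + g(y\<^sup>t) - f(x\<^sup>*) - g(y\<^sup>*)\<close>, \<open>r\<^sub>t = \<parallel>Ax\<^sup>t + By\<^sup>t - c\<parallel>\<close> and
  \<open>p = 1 - \<delta>\<close>,
  \<open>E\<^sub>t\<^sub>+\<^sub>1 + \<beta>\<^sub>t/2 r\<^sub>t\<^sub>+\<^sub>1\<^sup>2 \<le> (1 - \<alpha>\<^sub>t) E\<^sub>t + \<beta>\<^sub>t/2 (1 - 2\<alpha>\<^sub>t) r\<^sub>t\<^sup>2 + K (t+1)\<^sup>-\<^sup>1\<^sup>-\<^sup>p\<close>.
  As \<open>\<beta>\<^sub>t (1 - 2\<alpha>\<^sub>t) \<le> \<beta>\<^sub>t\<^sub>-\<^sub>1 (1 - \<alpha>\<^sub>t)\<close>, multiplication by \<open>(t+1)(t+2)\<close> makes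
  \<open>E\<^sub>t + \<beta>\<^sub>t\<^sub>-\<^sub>1/2 r\<^sub>t\<^sup>2\<close> telescope to \<open>O(t\<^sup>-\<^sup>p)\<close>. The constraint qualification gives
  \<open>E\<^sub>t \<ge> - \<Lambda> r\<^sub>t\<close>, which bounds \<open>r\<^sub>t\<close> and then \<open>E\<^sub>t\<close> from both sides.
\<close>

subsection \<open>Extended-valued convex functions\<close>

lemma proper_closed_convex_finite:
  assumes "proper_closed_convex f" and "z \<in> edom f"
  shows "f z = ereal (real_of_ereal (f z))"
  using assms by (cases "f z") (auto simp: proper_closed_convex_def edom_def)

text \<open>The graph points \<open>(z, real_of_ereal (f z))\<close> over the domain lie in the
  convex epigraph, hence so do their convex combinations. This reduces the later estimates to
  real-valued functions on \<open>edom f\<close>.\<close>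

lemma proper_closed_convex_convex_on:
  assumes "proper_closed_convex f"
  shows "convex_on (edom f) (\<lambda>z. real_of_ereal (f z))"
proof -
  have comb: "f (a *\<^sub>R v + b *\<^sub>R w) \<le> ereal (a * real_of_ereal (f v) + b * real_of_ereal (f w))"
    if "v \<in> edom f" "w \<in> edom f" "0 \<le> a" "0 \<le> b" "a + b = 1" for a b v w
  proof -
    have "(z, real_of_ereal (f z)) \<in> epi f" if "z \<in> edom f" for z
      using proper_closed_convex_finite[OF assms that] by (auto simp: epi_def)
    then have "a *\<^sub>R (v, real_of_ereal (f v)) + b *\<^sub>R (w, real_of_ereal (f w)) \<in> epi f"
      using assms that unfolding proper_closed_convex_def by (intro convexD) auto
    then show ?thesis by (simp add: epi_def)
  qed
  have conv: "convex (edom f)"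
  proof (rule convexI)
    fix v w a b
    assume "v \<in> edom f" "w \<in> edom f" "0 \<le> (a::real)" "0 \<le> b" "a + b = 1"
    from comb[OF this] show "a *\<^sub>R v + b *\<^sub>R w \<in> edom f"
      using le_less_trans[of "f (a *\<^sub>R v + b *\<^sub>R w)"] by (auto simp: edom_def)
  qed
  show ?thesis
    unfolding convex_on_def
  proof (intro conjI conv ballI allI impI)
    fix v w and a b :: real
    assume h: "v \<in> edom f" "w \<in> edom f" "0 \<le> a" "0 \<le> b" "a + b = 1"
    then have "a *\<^sub>R v + b *\<^sub>R w \<in> edom f" using convexD[OF conv] by blast
    from proper_closed_convex_finite[OF assms this] comb[OF h]
    show "real_of_ereal (f (a *\<^sub>R v + b *\<^sub>R w)) \<le> a * real_of_ereal (f v) + b * real_of_ereal (f w)"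
      by (metis ereal_less_eq(3))
  qed
qed

lemma dom_diameter_bound:
  assumes "dom_diameter f < \<infinity>"
  shows "\<exists>D\<ge>0. \<forall>v\<in>edom f. \<forall>w\<in>edom f. norm (v - w) \<le> D"
proof -
  from assms obtain D where D: "dom_diameter f < ereal D"
    using less_PInf_Ex_of_nat by (metis ereal_dense2)
  \<comment> \<open>\<open>max 0 D\<close> also covers an empty domain, whose supremum is minus
    infinity, so that \<open>D\<close> may be negative.\<close>
  have "norm (v - w) \<le> max 0 D" if "v \<in> edom f" "w \<in> edom f" for v w
  proof -
    have "ereal (norm (v - w)) \<le> dom_diameter f"
      unfolding dom_diameter_def using that by (intro SUP_upper2[where i="(v, w)"]) auto
    with D have "ereal (norm (v - w)) < ereal D" by order
    then show ?thesis by simp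
  qed
  then show ?thesis by (intro exI[of _ "max 0 D"]) auto
qed

text \<open>Comparison with one point of the domain forces a finite value at the minimizer; after
  that, minimality is an inequality between reals.\<close>

lemma is_arg_min_edom:
  assumes "proper_closed_convex h" and "is_arg_min (\<lambda>z. ereal (q z) + h z) (\<lambda>_. True) w"
  shows "w \<in> edom h"
    and "z \<in> edom h \<Longrightarrow> q w + real_of_ereal (h w) \<le> q z + real_of_ereal (h z)"
proof -
  obtain z0 where z0: "z0 \<in> edom h"
    using assms(1) by (auto simp: proper_closed_convex_def)
  have le: "ereal (q w) + h w \<le> ereal (q z) + h z" for z
    using assms(2) by (auto simp: is_arg_min_def not_less)
  show w: "w \<in> edom h"
    using le[of z0] z0 by (cases "h w"; cases "h z0") (auto simp: edom_def)
  show "q w + real_of_ereal (h w) \<le> q z + real_of_ereal (h z)" if z: "z \<in> edom h"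
  proof -
    obtain a b where "h w = ereal a" "h z = ereal b"
      using proper_closed_convex_finite[OF assms(1)] w z by blast
    then show ?thesis using le[of z] by simp
  qed
qed

lemma norm_add_scaleR_power2:
  fixes v w :: "'a::real_inner"
  shows "(norm (v + s *\<^sub>R w))\<^sup>2 = (norm v)\<^sup>2 + 2 * s * (v \<bullet> w) + s\<^sup>2 * (norm w)\<^sup>2"
  unfolding power2_norm_eq_inner power2_eq_square[of s]
  by (simp add: inner_add_left inner_add_right inner_commute algebra_simps)

subsection \<open>The largest eigenvalue\<close>

text \<open>By compactness the norm of \<open>A v\<close> has a maximizer \<open>v0\<close> on the
  unit sphere. First-order optimality there makes the maximum \<open>l\<close> an eigenvalue, and
  every eigenvalue is a value of the same Rayleigh quotient, hence at most \<open>l\<close>. So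
  \<open>GREATEST\<close> in \<open>lambda_max\<close> is attained.\<close>

lemma norm_le_lambda_max:
  fixes A :: "'a::euclidean_space \<Rightarrow> 'c::euclidean_space"
  assumes "linear A"
  shows "(norm (A v))\<^sup>2 \<le> lambda_max (adjoint A \<circ> A) * (norm v)\<^sup>2"
proof -
  interpret A: linear A by fact
  have bl: "bounded_linear A" using assms by (simp add: linear_conv_bounded_linear)
  have adj: "w \<bullet> adjoint A (A v) = A w \<bullet> A v" for v w
    by (rule adjoint_works[OF assms])
  have "compact (sphere 0 1 :: 'a set)" "sphere 0 1 \<noteq> ({} :: 'a set)" by auto
  moreover have "continuous_on (sphere 0 1) (\<lambda>v. (norm (A v))\<^sup>2)"
    by (intro continuous_intros linear_continuous_on bl)
  ultimately obtain v0 where v0: "v0 \<in> sphere 0 1"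
    and max: "\<And>v. v \<in> sphere 0 1 \<Longrightarrow> (norm (A v))\<^sup>2 \<le> (norm (A v0))\<^sup>2"
    using continuous_attains_sup[of "sphere 0 1" "\<lambda>v. (norm (A v))\<^sup>2"] by blast
  define l where "l = (norm (A v0))\<^sup>2"
  have bound: "(norm (A v))\<^sup>2 \<le> l * (norm v)\<^sup>2" for v
  proof (cases "v = 0")
    case False
    then have "(norm (A ((1 / norm v) *\<^sub>R v)))\<^sup>2 \<le> l"
      unfolding l_def by (intro max) auto
    then show ?thesis using False
      by (simp add: A.scaleR power_divide field_simps)
  qed (simp add: A.zero)
  have "adjoint A (A v0) = l *\<^sub>R v0"
  proof -
    \<comment> \<open>\<open>w\<close> is the defect in the eigenvector equation. The quadratic form
      \<open>l * (norm v)\<^sup>2 - (norm (A v))\<^sup>2\<close> is nonnegative and vanishes at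
      \<open>v0\<close>, so its slope along \<open>w\<close>, which is
      \<open>2 * (w \<bullet> w)\<close>, must be zero.\<close>
    define w where "w = l *\<^sub>R v0 - adjoint A (A v0)"
    have "w \<bullet> w = w \<bullet> (l *\<^sub>R v0 - adjoint A (A v0))" by (simp add: w_def)
    then have ww: "l * (w \<bullet> v0) - A w \<bullet> A v0 = w \<bullet> w"
      by (simp add: inner_diff_right adj)
    define k where "k = l * (norm w)\<^sup>2 - (norm (A w))\<^sup>2"
    have quad: "0 \<le> 2 * s * (w \<bullet> w) + s\<^sup>2 * k" for s
    proof -
      have "0 \<le> l * (norm (v0 + s *\<^sub>R w))\<^sup>2 - (norm (A (v0 + s *\<^sub>R w)))\<^sup>2"
        using bound[of "v0 + s *\<^sub>R w"] by simp
      also have "\<dots> = (l * (norm v0)\<^sup>2 - (norm (A v0))\<^sup>2) + 2 * s * (l * (w \<bullet> v0) - A w \<bullet> A v0) + s\<^sup>2 * k"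
        unfolding k_def
        by (simp add: A.add A.scaleR norm_add_scaleR_power2 inner_commute algebra_simps)
      also have "l * (norm v0)\<^sup>2 - (norm (A v0))\<^sup>2 = 0" using v0 by (simp add: l_def)
      finally show ?thesis using ww by simp
    qed
    have "w \<bullet> w \<le> 0"
    proof (rule ccontr)
      assume pos: "\<not> w \<bullet> w \<le> 0"
      \<comment> \<open>This length gives \<open>\<bar>s * k\<bar> \<le> w \<bullet> w\<close>, so
        the linear term outweighs the quadratic one, and the sign of \<open>s\<close> makes the sum
        negative.\<close>
      define s where "s = - (w \<bullet> w) / (1 + \<bar>k\<bar>)"
      have "s < 0" using pos unfolding s_def by (intro divide_neg_pos) auto
      moreover have "2 * (w \<bullet> w) + s * k > 0"
      proof -
        have "\<bar>s * k\<bar> = (w \<bullet> w) * (\<bar>k\<bar> / (1 + \<bar>k\<bar>))"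
          by (simp add: s_def abs_mult)
        also have "\<dots> \<le> (w \<bullet> w) * 1" by (intro mult_left_mono) auto
        finally have "\<bar>s * k\<bar> \<le> w \<bullet> w" by simp
        then show ?thesis using pos by linarith
      qed
      ultimately have "s * (2 * (w \<bullet> w) + s * k) < 0" by (rule mult_neg_pos)
      with quad[of s] show False by (simp add: algebra_simps power2_eq_square)
    qed
    then have "w = 0" by (metis inner_eq_zero_iff inner_ge_zero order_antisym)
    then show ?thesis by (simp add: w_def)
  qed
  then have ev: "is_eigenvalue (adjoint A \<circ> A) l"
    unfolding is_eigenvalue_def using v0 by (intro exI[of _ v0]) auto
  moreover have "m \<le> l" if m: "is_eigenvalue (adjoint A \<circ> A) m" for m
  proof -
    from m obtain v where "v \<noteq> 0" and v: "adjoint A (A v) = m *\<^sub>R v"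
      by (auto simp: is_eigenvalue_def)
    have "m * (norm v)\<^sup>2 = (norm (A v))\<^sup>2"
      using adj[of v v] v by (simp add: power2_norm_eq_inner)
    with bound[of v] have "m * (norm v)\<^sup>2 \<le> l * (norm v)\<^sup>2" by simp
    then show ?thesis using \<open>v \<noteq> 0\<close> by (simp add: mult_le_cancel_right)
  qed
  ultimately have "lambda_max (adjoint A \<circ> A) = l"
    unfolding lambda_max_def by (rule Greatest_equality)
  with bound show ?thesis by simp
qed

lemma lambda_max_nonneg:
  fixes A :: "'a::euclidean_space \<Rightarrow> 'c::euclidean_space"
  assumes "linear A"
  shows "0 \<le> lambda_max (adjoint A \<circ> A)"
proof -
  obtain b :: 'a where "b \<in> Basis" by (metis nonempty_Basis ex_in_conv)
  then have "(norm b)\<^sup>2 = 1" by simp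
  with norm_le_lambda_max[OF assms, of b] show ?thesis
    by (metis mult.right_neutral order_trans zero_le_power2)
qed

subsection \<open>One iteration\<close>

text \<open>Restriction to the line through \<open>z\<close> and \<open>w\<close> reduces this to
  the tangent inequality in one real variable.\<close>

lemma gderiv_convex_above_tangent:
  fixes f :: "'a::euclidean_space \<Rightarrow> real"
  assumes conv: "convex_on UNIV f" and der: "GDERIV f z :> d"
  shows "f z + d \<bullet> (w - z) \<le> f w"
proof -
  let ?F = "\<lambda>s::real. f (z + s *\<^sub>R (w - z))"
  have "(f has_derivative (\<lambda>h. h \<bullet> d)) (at (z + 0 *\<^sub>R (w - z)))"
    using der by (simp add: gderiv_def)
  moreover have "((\<lambda>s. z + s *\<^sub>R (w - z)) has_derivative (\<lambda>s. s *\<^sub>R (w - z))) (at 0)"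
    by (auto intro!: derivative_eq_intros)
  ultimately have "(?F has_derivative (\<lambda>s. (s *\<^sub>R (w - z)) \<bullet> d)) (at 0)"
    by (rule has_derivative_compose[rotated])
  then have d: "(?F has_real_derivative d \<bullet> (w - z)) (at 0)"
    by (rule has_derivative_imp_has_field_derivative) (simp add: inner_commute)
  have "convex_on UNIV ?F"
  proof (rule convex_onI)
    fix s a b :: real
    assume "0 < s" "s < 1"
    have "z + ((1 - s) *\<^sub>R a + s *\<^sub>R b) *\<^sub>R (w - z)
        = (1 - s) *\<^sub>R (z + a *\<^sub>R (w - z)) + s *\<^sub>R (z + b *\<^sub>R (w - z))"
      by (simp add: algebra_simps)
    then show "?F ((1 - s) *\<^sub>R a + s *\<^sub>R b) \<le> (1 - s) * ?F a + s * ?F b"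
      using convex_onD[OF conv, of s] \<open>0 < s\<close> \<open>s < 1\<close> by simp
  qed simp
  then have "?F 1 - ?F 0 \<ge> (d \<bullet> (w - z)) * (1 - 0)"
    using d by (intro convex_on_imp_above_tangent[where A=UNIV]) (auto simp: connected_UNIV)
  then show ?thesis by simp
qed

text \<open>The extra term \<open>L / 2 * (norm (p - z))\<^sup>2\<close> expresses strong convexity
  of the proximal objective at its minimizer. Minimality is tested on the segment from
  \<open>p\<close> to \<open>z\<close>, divided by \<open>s\<close>, and \<open>s\<close> tends to
  \<open>0\<close>.\<close>

lemma prox_inequality:
  fixes h :: "'a::real_inner \<Rightarrow> real"
  assumes conv: "convex_on X h" and X: "p \<in> X" "z \<in> X"
    and min: "\<And>z. z \<in> X \<Longrightarrow>
      a \<bullet> (p - v) + L / 2 * (norm (p - v))\<^sup>2 + h p \<le> a \<bullet> (z - v) + L / 2 * (norm (z - v))\<^sup>2 + h z"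
  shows "a \<bullet> (p - v) + L / 2 * (norm (p - v))\<^sup>2 + h p + L / 2 * (norm (p - z))\<^sup>2
    \<le> a \<bullet> (z - v) + L / 2 * (norm (z - v))\<^sup>2 + h z"
proof -
  \<comment> \<open>\<open>?k\<close> bounds the one-sided derivative of the objective at
    \<open>p\<close> towards \<open>z\<close>, with the slope of \<open>h\<close> replaced by its
    chord \<open>h z - h p\<close>.\<close>
  let ?k = "a \<bullet> (z - p) + L * ((p - v) \<bullet> (z - p)) + h z - h p"
  have "0 \<le> ?k + s * (L / 2 * (norm (z - p))\<^sup>2)" if s: "0 < s" "s < 1" for s
  proof -
    let ?z = "(1 - s) *\<^sub>R p + s *\<^sub>R z"
    have eq: "?z - v = (p - v) + s *\<^sub>R (z - p)" by (simp add: algebra_simps)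
    have "h ?z \<le> (1 - s) * h p + s * h z"
      using s X by (intro convex_onD[OF conv]) auto
    moreover have "?z \<in> X"
      using s X convex_on_imp_convex[OF conv] by (intro convexD_alt) auto
    ultimately have "a \<bullet> (p - v) + L / 2 * (norm (p - v))\<^sup>2 + h p
        \<le> a \<bullet> (?z - v) + L / 2 * (norm (?z - v))\<^sup>2 + (1 - s) * h p + s * h z"
      using min[of ?z] by linarith
    then have "0 \<le> s * (?k + s * (L / 2 * (norm (z - p))\<^sup>2))"
      unfolding eq norm_add_scaleR_power2
      by (simp add: inner_add_right algebra_simps power2_eq_square)
    with s show ?thesis by (simp add: zero_le_mult_iff)
  qed
  then have "\<forall>\<^sub>F s in at_right 0. 0 \<le> ?k + s * (L / 2 * (norm (z - p))\<^sup>2)"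
    by (auto simp: eventually_at_right_field intro!: exI[of _ 1])
  moreover have "((\<lambda>s. ?k + s * (L / 2 * (norm (z - p))\<^sup>2)) \<longlongrightarrow> ?k + 0 * (L / 2 * (norm (z - p))\<^sup>2))
      (at_right 0)"
    by (intro tendsto_intros)
  ultimately have "0 \<le> ?k + 0 * (L / 2 * (norm (z - p))\<^sup>2)"
    by (intro tendsto_lowerbound[where F = "at_right 0"]) auto
  then have "0 \<le> ?k" by simp
  moreover have "L / 2 * (norm (z - v))\<^sup>2
      = L / 2 * (norm (p - v))\<^sup>2 + L * ((p - v) \<bullet> (z - p)) + L / 2 * (norm (p - z))\<^sup>2"
    using norm_add_scaleR_power2[of "p - v" 1 "z - p"]
    by (simp add: norm_minus_commute[of p z] distrib_left)
  moreover have "a \<bullet> (z - v) = a \<bullet> (p - v) + a \<bullet> (z - p)"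
    by (simp add: inner_diff_right)
  ultimately show ?thesis by linarith
qed

text \<open>In use, \<open>w\<close> is \<open>B y - c\<close> and \<open>\<omega>\<close> the
  Hoelder remainder. The prox inequality is applied at \<open>v + a *\<^sub>R (xs - v)\<close>. The
  part \<open>l * b\<close> of the weight pays for the curvature of the penalty between
  \<open>v\<close> and \<open>p\<close>, the part \<open>H\<close> is left to compensate
  \<open>\<omega>\<close>, and the strong convexity term stays on the left for
  \<open>penalty_descent\<close>.\<close>

lemma proximal_step:
  fixes A :: "'a::euclidean_space \<Rightarrow> 'c::euclidean_space"
  assumes A: "linear A" "\<And>v. (norm (A v))\<^sup>2 \<le> l * (norm v)\<^sup>2"
    and h: "convex_on X h" and X: "p \<in> X" "v \<in> X" "xs \<in> X"
    and a: "0 \<le> a" "a \<le> 1" and b: "0 \<le> b"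
    and tangent: "\<phi> v + d \<bullet> (xs - v) \<le> \<phi> xs"
    and smooth: "\<phi> p \<le> \<phi> v + d \<bullet> (p - v) + \<omega>"
    and min: "\<And>z. z \<in> X \<Longrightarrow>
      (d + b *\<^sub>R adjoint A (A v + w)) \<bullet> (p - v) + (H + l * b) / 2 * (norm (p - v))\<^sup>2 + h p
      \<le> (d + b *\<^sub>R adjoint A (A v + w)) \<bullet> (z - v) + (H + l * b) / 2 * (norm (z - v))\<^sup>2 + h z"
  shows "\<phi> p + h p + b / 2 * (norm (A p + w))\<^sup>2 + (H + l * b) / 2 * (norm (p - (v + a *\<^sub>R (xs - v))))\<^sup>2
    \<le> (1 - a) * (\<phi> v + h v) + a * (\<phi> xs + h xs) + b / 2 * (norm (A v + w))\<^sup>2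
      + b * a * ((A v + w) \<bullet> A (xs - v)) + (H + l * b) / 2 * a\<^sup>2 * (norm (xs - v))\<^sup>2
      + (\<omega> - H / 2 * (norm (p - v))\<^sup>2)"
proof -
  let ?R = "A v + w" and ?q = "v + a *\<^sub>R (xs - v)"
  have q: "?q = (1 - a) *\<^sub>R v + a *\<^sub>R xs" by (simp add: algebra_simps)
  then have "?q \<in> X"
    using convexD_alt[OF convex_on_imp_convex[OF h] X(2,3) a] by simp
  note prox = prox_inequality[OF h \<open>p \<in> X\<close> this min]
  have inner: "(d + b *\<^sub>R adjoint A ?R) \<bullet> k = d \<bullet> k + b * (?R \<bullet> A k)" for k
    by (simp only: inner_add_left[of d] inner_scaleR_left inner_commute[of "adjoint A ?R" k]
        adjoint_works[OF A(1)] inner_commute[of "A k" ?R])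
  have "h ?q \<le> (1 - a) * h v + a * h xs"
    unfolding q using a X by (intro convex_onD[OF h]) auto
  moreover have "(d + b *\<^sub>R adjoint A ?R) \<bullet> (?q - v) = a * (d \<bullet> (xs - v)) + b * a * (?R \<bullet> A (xs - v))"
    by (simp add: inner linear_scale[OF A(1)] distrib_left mult_ac)
  moreover have "(norm (?q - v))\<^sup>2 = a\<^sup>2 * (norm (xs - v))\<^sup>2"
    by (simp add: power_mult_distrib)
  then have "(H + l * b) / 2 * (norm (?q - v))\<^sup>2 = (H + l * b) / 2 * a\<^sup>2 * (norm (xs - v))\<^sup>2"
    by simp
  moreover have "b / 2 * (norm (A p + w))\<^sup>2
      \<le> b / 2 * (norm ?R)\<^sup>2 + b * (?R \<bullet> A (p - v)) + l * b / 2 * (norm (p - v))\<^sup>2"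
  proof -
    have "A p + w = ?R + 1 *\<^sub>R A (p - v)" by (simp add: linear_diff[OF A(1)])
    then have "(norm (A p + w))\<^sup>2 = (norm ?R)\<^sup>2 + 2 * (?R \<bullet> A (p - v)) + (norm (A (p - v)))\<^sup>2"
      by (simp only: norm_add_scaleR_power2) simp
    also have "\<dots> \<le> (norm ?R)\<^sup>2 + 2 * (?R \<bullet> A (p - v)) + l * (norm (p - v))\<^sup>2"
      using A(2) by simp
    finally have "b / 2 * (norm (A p + w))\<^sup>2
        \<le> b / 2 * ((norm ?R)\<^sup>2 + 2 * (?R \<bullet> A (p - v)) + l * (norm (p - v))\<^sup>2)"
      using b by (intro mult_left_mono) auto
    then show ?thesis by (simp add: algebra_simps)
  qed
  moreover have "a * (\<phi> v + d \<bullet> (xs - v)) \<le> a * \<phi> xs"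
    using tangent a by (intro mult_left_mono)
  then have "a * \<phi> v + a * (d \<bullet> (xs - v)) \<le> a * \<phi> xs" by (simp add: distrib_left)
  moreover have "(H + l * b) / 2 * (norm (p - v))\<^sup>2 = H / 2 * (norm (p - v))\<^sup>2 + l * b / 2 * (norm (p - v))\<^sup>2"
    by (simp add: algebra_simps add_divide_distrib)
  moreover have "(1 - a) * (\<phi> v + h v) + a * (\<phi> xs + h xs)
      = \<phi> v - a * \<phi> v + (1 - a) * h v + a * \<phi> xs + a * h xs"
    by (simp add: algebra_simps)
  ultimately show ?thesis
    using prox inner[of "p - v"] smooth by linarith
qed

text \<open>Optimality of \<open>u\<close> in the linearised problem is tested at \<open>ys\<close>
  and scaled by \<open>a\<close>. As \<open>p\<close> moves only the fraction \<open>a\<close>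
  towards \<open>u\<close>, the curvature of the penalty costs an error of order
  \<open>a\<^sup>2\<close>.\<close>

lemma conditional_gradient_step:
  fixes B :: "'b::euclidean_space \<Rightarrow> 'c::euclidean_space"
  assumes B: "linear B"
    and h: "convex_on Y h" and Y: "u \<in> Y" "v \<in> Y"
    and a: "0 \<le> a" "a \<le> 1"
    and tangent: "\<phi> v + d \<bullet> (ys - v) \<le> \<phi> ys"
    and smooth: "\<phi> p \<le> \<phi> v + d \<bullet> (p - v) + \<omega>"
    and p: "p = v + a *\<^sub>R (u - v)"
    and min: "(d + b *\<^sub>R adjoint B (B v + w)) \<bullet> u + h u
      \<le> (d + b *\<^sub>R adjoint B (B v + w)) \<bullet> ys + h ys"
  shows "\<phi> p + h p + b / 2 * (norm (B p + w))\<^sup>2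
    \<le> (1 - a) * (\<phi> v + h v) + a * (\<phi> ys + h ys) + b / 2 * (norm (B v + w))\<^sup>2
      + b * a * ((B v + w) \<bullet> B (ys - v)) + (\<omega> + b / 2 * a\<^sup>2 * (norm (B (u - v)))\<^sup>2)"
proof -
  let ?R = "B v + w"
  have inner: "(d + b *\<^sub>R adjoint B ?R) \<bullet> k = d \<bullet> k + b * (?R \<bullet> B k)" for k
    by (simp only: inner_add_left[of d] inner_scaleR_left inner_commute[of "adjoint B ?R" k]
        adjoint_works[OF B] inner_commute[of "B k" ?R])
  have "h p \<le> (1 - a) * h v + a * h u"
    using a Y convex_onD[OF h, of a v u] by (simp add: p algebra_simps)
  moreover have "a * ((d + b *\<^sub>R adjoint B ?R) \<bullet> u + h u)
      \<le> a * ((d + b *\<^sub>R adjoint B ?R) \<bullet> ys + h ys)"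
    using min a by (intro mult_left_mono)
  then have "a * (d \<bullet> u) + a * b * (?R \<bullet> B u) + a * h u
      \<le> a * (d \<bullet> ys) + a * b * (?R \<bullet> B ys) + a * h ys"
    unfolding inner by (simp add: distrib_left mult.assoc)
  moreover have "B p + w = ?R + a *\<^sub>R B (u - v)"
    by (simp add: p linear_diff[OF B] linear_add[OF B] linear_scale[OF B])
  then have "b / 2 * (norm (B p + w))\<^sup>2
      = b / 2 * (norm ?R)\<^sup>2 + a * b * (?R \<bullet> B u) - a * b * (?R \<bullet> B v) + b / 2 * a\<^sup>2 * (norm (B (u - v)))\<^sup>2"
    by (simp only: norm_add_scaleR_power2) (simp add: linear_diff[OF B] inner_diff_right algebra_simps)
  moreover have "a * (\<phi> v + d \<bullet> (ys - v)) \<le> a * \<phi> ys"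
    using tangent a by (intro mult_left_mono)
  then have "a * \<phi> v + a * (d \<bullet> ys) - a * (d \<bullet> v) \<le> a * \<phi> ys"
    by (simp add: inner_diff_right algebra_simps)
  moreover have "d \<bullet> (p - v) = a * (d \<bullet> u) - a * (d \<bullet> v)"
    by (simp add: p inner_diff_right algebra_simps)
  moreover have "b * a * (?R \<bullet> B (ys - v)) = a * b * (?R \<bullet> B ys) - a * b * (?R \<bullet> B v)"
    by (simp add: linear_diff[OF B] inner_diff_right algebra_simps)
  moreover have "(1 - a) * (\<phi> v + h v) + a * (\<phi> ys + h ys)
      = \<phi> v - a * \<phi> v + (1 - a) * h v + a * \<phi> ys + a * h ys"
    by (simp add: algebra_simps)
  ultimately show ?thesis using smooth by linarith
qed

text \<open>Young's inequality, from a nonnegative square.\<close>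

lemma mult_inner_le_power2:
  fixes v w :: "'a::real_inner"
  assumes "0 \<le> b"
  shows "b * a * (v \<bullet> w) \<le> b / 2 * (norm v)\<^sup>2 + b / 2 * a\<^sup>2 * (norm w)\<^sup>2"
proof -
  have "0 \<le> b / 2 * (norm (v + (- a) *\<^sub>R w))\<^sup>2" using assms by simp
  then show ?thesis
    by (simp only: norm_add_scaleR_power2) (simp add: algebra_simps)
qed

text \<open>On adding the two steps, the penalty at the intermediate point
  \<open>A p + B y - c\<close> cancels. Feasibility of \<open>(xs, ys)\<close> turns the inner
  products into \<open>- (norm r)\<^sup>2\<close>, the source of the factor
  \<open>1 - 2 * a\<close>, plus couplings with \<open>k\<close>. The coupling with
  \<open>A m\<close> is absorbed by the retained prox term.\<close>

lemma penalty_descent: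
  fixes A :: "'a::euclidean_space \<Rightarrow> 'c::euclidean_space"
    and B :: "'b::euclidean_space \<Rightarrow> 'c"
  assumes A: "linear A" "\<And>v. (norm (A v))\<^sup>2 \<le> l * (norm v)\<^sup>2" and B: "linear B"
    and b: "0 \<le> b" and H: "0 \<le> H" and feasible: "A xs + B ys = c"
    and x_step: "Fp + b / 2 * (norm (A p + (B y - c)))\<^sup>2
        + (H + l * b) / 2 * (norm (p - (x + a *\<^sub>R (xs - x))))\<^sup>2
      \<le> (1 - a) * F + a * Fs + b / 2 * (norm (A x + (B y - c)))\<^sup>2
        + b * a * ((A x + (B y - c)) \<bullet> A (xs - x)) + e1 + e2"
    and y_step: "Gp + b / 2 * (norm (B yp + (A p - c)))\<^sup>2
      \<le> (1 - a) * G + a * Gs + b / 2 * (norm (B y + (A p - c)))\<^sup>2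
        + b * a * ((B y + (A p - c)) \<bullet> B (ys - y)) + e3"
  shows "Fp + Gp - (Fs + Gs) + b / 2 * (norm (A p + B yp - c))\<^sup>2
    \<le> (1 - a) * (F + G - (Fs + Gs)) + b / 2 * (1 - 2 * a) * (norm (A x + B y - c))\<^sup>2
      + e1 + e2 + e3 + b / 2 * a\<^sup>2 * (l * (norm (xs - x))\<^sup>2 + 2 * (norm (B (ys - y)))\<^sup>2)"
proof -
  define r where "r = A x + B y - c"
  define m where "m = p - (x + a *\<^sub>R (xs - x))"
  define k where "k = B (ys - y)"
  have Ak: "A (xs - x) = - r - k"
    unfolding r_def k_def using feasible by (simp add: linear_diff[OF A(1)] linear_diff[OF B] algebra_simps)
  have Ap: "B y + (A p - c) = r + a *\<^sub>R A (xs - x) + A m"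
    unfolding r_def m_def
    by (simp add: linear_diff[OF A(1)] linear_add[OF A(1)] linear_scale[OF A(1)])
  have eqs: "A x + (B y - c) = r" "A p + (B y - c) = B y + (A p - c)" "B yp + (A p - c) = A p + B yp - c"
    by (simp_all add: r_def)
  \<comment> \<open>Substituting \<open>A (xs - x) = - r - k\<close> in the first product only makes
    the two terms \<open>r \<bullet> k\<close> cancel.\<close>
  have "r \<bullet> A (xs - x) + (B y + (A p - c)) \<bullet> k = - (norm r)\<^sup>2 + a * (A (xs - x) \<bullet> k) + A m \<bullet> k"
    unfolding Ap by (subst Ak) (simp add: power2_norm_eq_inner inner_add_left inner_diff_right)
  then have "b * a * (r \<bullet> A (xs - x)) + b * a * ((B y + (A p - c)) \<bullet> k)
      = b * a * (- (norm r)\<^sup>2 + a * (A (xs - x) \<bullet> k) + A m \<bullet> k)"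
    by (simp only: distrib_left[symmetric])
  then have cross: "b * a * (r \<bullet> A (xs - x)) + b * a * ((B y + (A p - c)) \<bullet> k)
      = - (b * a * (norm r)\<^sup>2) + b * a\<^sup>2 * (A (xs - x) \<bullet> k) + b * a * (A m \<bullet> k)"
    by (simp add: algebra_simps power2_eq_square)
  have "b * a * (A m \<bullet> k) \<le> b / 2 * (norm (A m))\<^sup>2 + b / 2 * a\<^sup>2 * (norm k)\<^sup>2"
    by (rule mult_inner_le_power2[OF b])
  moreover have "b / 2 * (norm (A m))\<^sup>2 \<le> b / 2 * (l * (norm m)\<^sup>2)"
    using A(2) b by (intro mult_left_mono) auto
  moreover have "b * a\<^sup>2 * (A (xs - x) \<bullet> k)
      \<le> b * a\<^sup>2 / 2 * (norm (A (xs - x)))\<^sup>2 + b / 2 * a\<^sup>2 * (norm k)\<^sup>2"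
    using mult_inner_le_power2[of "b * a\<^sup>2" 1 "A (xs - x)" k] b by simp
  moreover have "b * a\<^sup>2 / 2 * (norm (A (xs - x)))\<^sup>2 \<le> b * a\<^sup>2 / 2 * (l * (norm (xs - x))\<^sup>2)"
    using A(2) b by (intro mult_left_mono) auto
  moreover have "0 \<le> H / 2 * (norm m)\<^sup>2" using H by simp
  moreover have "(H + l * b) / 2 * (norm m)\<^sup>2 = H / 2 * (norm m)\<^sup>2 + b / 2 * (l * (norm m)\<^sup>2)"
    by (simp add: algebra_simps add_divide_distrib)
  moreover have "b / 2 * (1 - 2 * a) * (norm r)\<^sup>2 = b / 2 * (norm r)\<^sup>2 - b * a * (norm r)\<^sup>2"
    by (simp add: algebra_simps)
  moreover have "b / 2 * a\<^sup>2 * (l * (norm (xs - x))\<^sup>2 + 2 * (norm k)\<^sup>2)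
      = b * a\<^sup>2 / 2 * (l * (norm (xs - x))\<^sup>2) + 2 * (b / 2 * a\<^sup>2 * (norm k)\<^sup>2)"
    by (simp add: algebra_simps add_divide_distrib)
  moreover have "(1 - a) * (F + G - (Fs + Gs)) = (1 - a) * F + (1 - a) * G + a * Fs + a * Gs - Fs - Gs"
    by (simp add: algebra_simps)
  ultimately show ?thesis
    using x_step[unfolded eqs, folded m_def] y_step[unfolded eqs, folded k_def] cross
    unfolding k_def[symmetric] r_def[symmetric] by linarith
qed

subsection \<open>Lagrange multipliers\<close>

text \<open>\<open>P\<close> plays the role of the epigraph of the value function \<open>z \<mapsto> inf {f x + g y - \<Phi> | A x + B y - c = z}\<close>.
  That function is bounded above on a neighbourhood of \<open>0\<close> in \<open>Q\<close> (a polytope), and convexity along the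
  segment from \<open>z\<close> through \<open>0\<close> to its boundary then bounds it below linearly.\<close>

lemma rel_interior_zero_lower_bound:
  fixes Q :: "'c::euclidean_space set" and P :: "'c \<Rightarrow> real \<Rightarrow> bool"
  assumes zero: "0 \<in> rel_interior Q" and Q: "\<And>z. z \<in> Q \<longleftrightarrow> (\<exists>e. P z e)"
    and mono: "\<And>z e e'. P z e \<Longrightarrow> e \<le> e' \<Longrightarrow> P z e'"
    and conv: "\<And>z w d e s. P z d \<Longrightarrow> P w e \<Longrightarrow> 0 \<le> s \<Longrightarrow> s \<le> 1 \<Longrightarrow>
      P ((1 - s) *\<^sub>R z + s *\<^sub>R w) ((1 - s) * d + s * e)"
    and nonneg: "\<And>e. P 0 e \<Longrightarrow> 0 \<le> e"
  shows "\<exists>\<Lambda>\<ge>0. \<forall>z e. P z e \<longrightarrow> - \<Lambda> * norm z \<le> e"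
proof -
  have convQ: "convex Q"
    unfolding convex_alt
  proof safe
    fix z w and s :: real assume "z \<in> Q" "w \<in> Q" and s: "0 \<le> s" "s \<le> 1"
    then obtain d e where "P z d" "P w e" using Q by blast
    from conv[OF this s] show "(1 - s) *\<^sub>R z + s *\<^sub>R w \<in> Q" using Q by blast
  qed
  have "0 \<in> Q" using zero rel_interior_subset by blast
  have hull: "affine hull Q = span Q"
    using \<open>0 \<in> Q\<close> by (intro affine_hull_span_0 hull_inc)
  \<comment> \<open>\<open>V\<close> is a basis of the span of \<open>Q\<close> taken inside
    \<open>Q\<close>. Adding a negative multiple of each basis vector gives a polytope with
    \<open>0\<close> in its relative interior.\<close>
  obtain V where V: "V \<subseteq> Q" "independent V" "Q \<subseteq> span V"
    using maximal_independent_subset by blast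
  have "finite V" using V(2) by (rule finiteI_independent)
  have "\<exists>k>0. - k *\<^sub>R v \<in> Q" if v: "v \<in> Q" for v
  proof -
    obtain m where "m > 1" "(1 - m) *\<^sub>R v + m *\<^sub>R 0 \<in> Q"
      using bspec[OF convex_rel_interior_if2[OF convQ zero] hull_inc[OF v]] by auto
    then show ?thesis by (intro exI[of _ "m - 1"]) auto
  qed
  then obtain k where k: "\<And>v. v \<in> Q \<Longrightarrow> 0 < k v" "\<And>v. v \<in> Q \<Longrightarrow> - k v *\<^sub>R v \<in> Q"
    by metis
  define W where "W = insert 0 (V \<union> (\<lambda>v. - k v *\<^sub>R v) ` V)"
  have W: "finite W" "W \<subseteq> Q" "W \<noteq> {}"
    using \<open>finite V\<close> V(1) k(2) \<open>0 \<in> Q\<close> by (auto simp: W_def)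
  from W(2) Q have "\<forall>w\<in>W. \<exists>e. P w e" by blast
  then obtain e where e: "\<And>w. w \<in> W \<Longrightarrow> P w (e w)" by metis
  \<comment> \<open>The maximum with \<open>0\<close> ensures that the multiplier
    \<open>M / \<rho>\<close> is nonnegative.\<close>
  define M where "M = max 0 (Max (e ` W))"
  have "P w M" if "w \<in> W" for w
  proof (rule mono[OF e[OF that]])
    have "e w \<le> Max (e ` W)" using W(1) that by (intro Max_ge) auto
    then show "e w \<le> M" by (simp add: M_def)
  qed
  moreover have "convex {z. P z M}"
    unfolding convex_alt
  proof clarsimp
    fix z w s assume "P z M" "P w M" "0 \<le> s" "s \<le> (1::real)"
    from conv[OF this] show "P ((1 - s) *\<^sub>R z + s *\<^sub>R w) M" by (simp add: algebra_simps)
  qed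
  ultimately have PM: "P z M" if "z \<in> convex hull W" for z
    using subsetD[OF hull_minimal[of W "{z. P z M}" convex] that] by auto
  let ?C = "convex hull W"
  have "0 \<in> ?C" by (intro hull_inc) (simp add: W_def)
  have "0 \<in> rel_interior ?C"
  proof (subst convex_rel_interior_iff)
    \<comment> \<open>\<open>0\<close> is relatively interior to \<open>?C\<close> once every point
      of \<open>?C\<close> has a negative multiple in \<open>?C\<close>. The points with this
      property form a convex set, so checking the generators \<open>W\<close> is enough. Since
      \<open>0 \<in> ?C\<close>, two multipliers may be shrunk to their minimum.\<close>
    have "convex {z. \<exists>k>0. - k *\<^sub>R z \<in> ?C}"
    proof (rule iffD2[OF convex_alt], intro ballI allI impI)
      fix z w and s :: real
      assume "z \<in> {z. \<exists>k>0. - k *\<^sub>R z \<in> ?C}" "w \<in> {z. \<exists>k>0. - k *\<^sub>R z \<in> ?C}" "0 \<le> s \<and> s \<le> 1"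
      then obtain i j where
        h: "0 \<le> s" "s \<le> 1" "0 < i" "- (i *\<^sub>R z) \<in> ?C" "0 < j" "- (j *\<^sub>R w) \<in> ?C"
        by auto
      have shrink: "- (min i j *\<^sub>R v) \<in> ?C" if "- (k *\<^sub>R v) \<in> ?C" "k \<ge> min i j" "k > 0" for k v
      proof -
        have "(1 - min i j / k) *\<^sub>R 0 + (min i j / k) *\<^sub>R (- (k *\<^sub>R v)) \<in> ?C"
          using h that \<open>0 \<in> ?C\<close> by (intro convexD_alt convex_convex_hull) auto
        then show ?thesis using that by simp
      qed
      have "(1 - s) *\<^sub>R (- (min i j *\<^sub>R z)) + s *\<^sub>R (- (min i j *\<^sub>R w)) \<in> ?C"
        using h by (intro convexD_alt convex_convex_hull shrink[where k = i] shrink[where k = j]) auto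
      moreover have "(1 - s) *\<^sub>R (- (min i j *\<^sub>R z)) + s *\<^sub>R (- (min i j *\<^sub>R w))
          = - (min i j *\<^sub>R ((1 - s) *\<^sub>R z + s *\<^sub>R w))"
        by (simp add: scaleR_right_distrib mult.commute)
      ultimately have "- min i j *\<^sub>R ((1 - s) *\<^sub>R z + s *\<^sub>R w) \<in> ?C" by simp
      then show "(1 - s) *\<^sub>R z + s *\<^sub>R w \<in> {z. \<exists>k>0. - k *\<^sub>R z \<in> ?C}"
        using h by (intro CollectI exI[of _ "min i j"]) simp
    qed
    moreover have "W \<subseteq> {z. \<exists>k>0. - k *\<^sub>R z \<in> ?C}"
    proof
      fix w assume "w \<in> W"
      then consider "w = 0" | "w \<in> V" | v where "v \<in> V" "w = - k v *\<^sub>R v"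
        by (auto simp: W_def)
      then show "w \<in> {z. \<exists>k>0. - k *\<^sub>R z \<in> ?C}"
      proof cases
        case 1
        then show ?thesis using \<open>0 \<in> ?C\<close> by (auto intro: exI[of _ 1])
      next
        case 2
        then have "- k w *\<^sub>R w \<in> ?C" by (intro hull_inc) (auto simp: W_def)
        then show ?thesis using k(1) 2 V(1) by blast
      next
        case 3
        then have "v \<in> ?C" by (intro hull_inc) (auto simp: W_def)
        moreover have "0 < k v" using 3 V(1) k(1) by blast
        ultimately show ?thesis using 3 by (auto intro!: exI[of _ "1 / k v"])
      qed
    qed
    ultimately have "?C \<subseteq> {z. \<exists>k>0. - k *\<^sub>R z \<in> ?C}" by (rule hull_minimal[rotated])
    then show "\<forall>z\<in>?C. \<exists>m>1. (1 - m) *\<^sub>R z + m *\<^sub>R 0 \<in> ?C"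
    proof safe
      fix z assume "z \<in> ?C" "?C \<subseteq> {z. \<exists>k>0. - k *\<^sub>R z \<in> ?C}"
      then obtain k where "k > 0" "- k *\<^sub>R z \<in> ?C" by blast
      then show "\<exists>m>1. (1 - m) *\<^sub>R z + m *\<^sub>R 0 \<in> ?C" by (intro exI[of _ "1 + k"]) auto
    qed
  qed (use \<open>0 \<in> ?C\<close> convex_convex_hull in blast)+
  then obtain \<rho> where \<rho>: "\<rho> > 0" "cball 0 \<rho> \<inter> affine hull ?C \<subseteq> ?C"
    by (auto simp: mem_rel_interior_cball)
  have "affine hull ?C = span ?C" by (rule affine_hull_span_0[OF hull_inc[OF \<open>0 \<in> ?C\<close>]])
  moreover have "span Q \<subseteq> span ?C"
  proof -
    have "V \<subseteq> ?C" using hull_subset[of W convex] by (auto simp: W_def)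
    then show ?thesis using V(3) by (metis span_mono span_minimal subspace_span order_trans)
  qed
  ultimately have ball: "z \<in> ?C" if "z \<in> span Q" "norm z \<le> \<rho>" for z
    using that \<rho>(2) by auto
  have "- (M / \<rho>) * norm z \<le> d" if P: "P z d" for z d
  proof (cases "z = 0")
    case True
    then show ?thesis using P nonneg by auto
  next
    case False
    have "z \<in> Q" using P Q by blast
    have "- (\<rho> / norm z) *\<^sub>R z \<in> span Q"
      using \<open>z \<in> Q\<close> by (intro span_scale span_base)
    then have "P (- (\<rho> / norm z) *\<^sub>R z) M"
      using \<rho>(1) False by (intro PM ball) auto
    \<comment> \<open>\<open>s\<close> is the weight for which \<open>0\<close> is the combination
      of \<open>z\<close> and the opposite point at distance \<open>\<rho>\<close>, where
      \<open>M\<close> is an upper bound.\<close>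
    define s where "s = norm z / (\<rho> + norm z)"
    have pos: "\<rho> + norm z > 0" using \<rho>(1) by (simp add: add_pos_nonneg)
    have s: "0 \<le> s" "s \<le> 1" "1 - s = \<rho> / (\<rho> + norm z)"
      using pos \<rho>(1) by (auto simp: s_def field_simps)
    have eq: "(1 - s) *\<^sub>R z + s *\<^sub>R (- (\<rho> / norm z) *\<^sub>R z) = 0"
      unfolding s(3) using False by (simp add: s_def)
    have "P 0 ((1 - s) * d + s * M)"
      using conv[OF P \<open>P (- (\<rho> / norm z) *\<^sub>R z) M\<close> s(1,2)] unfolding eq .
    then have "0 \<le> (1 - s) * d + s * M" by (rule nonneg)
    also have "\<dots> = (\<rho> * d + norm z * M) / (\<rho> + norm z)"
      unfolding s(3) by (simp add: s_def add_divide_distrib)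
    finally have "0 \<le> \<rho> * d + norm z * M"
      using pos by (simp add: zero_le_divide_iff)
    then show ?thesis using \<rho>(1) by (simp add: field_simps)
  qed
  moreover have "0 \<le> M / \<rho>" using \<rho>(1) by (simp add: M_def)
  ultimately show ?thesis by blast
qed

text \<open>Relative interiors commute with linear images and sums of convex sets, so the constraint
  qualification says that \<open>0\<close> is relatively interior to the set \<open>Q\<close> of
  attainable residuals. \<open>\<Lambda>\<close> plays the role of a bound on a Lagrange
  multiplier.\<close>

lemma constraint_qualification_error_bound:
  fixes A :: "'a::euclidean_space \<Rightarrow> 'c::euclidean_space"
    and B :: "'b::euclidean_space \<Rightarrow> 'c"
  assumes A: "linear A" and B: "linear B"
    and F: "convex_on X F" and G: "convex_on Y G"
    and cq: "c \<in> A ` rel_interior X + B ` rel_interior Y"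
    and opt: "\<And>x y. x \<in> X \<Longrightarrow> y \<in> Y \<Longrightarrow> A x + B y = c \<Longrightarrow> \<Phi> \<le> F x + G y"
  shows "\<exists>\<Lambda>\<ge>0. \<forall>x\<in>X. \<forall>y\<in>Y. - \<Lambda> * norm (A x + B y - c) \<le> F x + G y - \<Phi>"
proof -
  define P where "P z e \<longleftrightarrow> (\<exists>x\<in>X. \<exists>y\<in>Y. z = A x + B y - c \<and> F x + G y - \<Phi> \<le> e)" for z e
  define Q where "Q = (\<lambda>z. - c + z) ` (A ` X + B ` Y)"
  have conv: "convex X" "convex Y" using F G convex_on_imp_convex by auto
  have "A ` rel_interior X + B ` rel_interior Y = rel_interior (A ` X + B ` Y)"
    using conv A B
    by (simp add: rel_interior_sum convex_linear_image rel_interior_convex_linear_image)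
  with cq have "0 \<in> rel_interior Q"
    unfolding Q_def rel_interior_translation by auto
  moreover have "z \<in> Q \<longleftrightarrow> (\<exists>e. P z e)" for z
  proof -
    have "z \<in> Q \<longleftrightarrow> (\<exists>x\<in>X. \<exists>y\<in>Y. z = A x + B y - c)"
      by (auto simp: Q_def set_plus_def image_iff algebra_simps)
    then show ?thesis unfolding P_def by blast
  qed
  moreover have "P z e'" if "P z e" "e \<le> e'" for z e e'
    using that unfolding P_def by force
  moreover have "P ((1 - s) *\<^sub>R z + s *\<^sub>R w) ((1 - s) * d + s * e)"
    if h: "P z d" "P w e" "0 \<le> s" "s \<le> 1" for z w d e s
  proof -
    from h obtain x y x' y' where
      xy: "x \<in> X" "y \<in> Y" "z = A x + B y - c" "F x + G y - \<Phi> \<le> d" and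
      xy': "x' \<in> X" "y' \<in> Y" "w = A x' + B y' - c" "F x' + G y' - \<Phi> \<le> e"
      unfolding P_def by blast
    let ?x = "(1 - s) *\<^sub>R x + s *\<^sub>R x'" and ?y = "(1 - s) *\<^sub>R y + s *\<^sub>R y'"
    have "?x \<in> X" "?y \<in> Y" using conv xy xy' h by (auto intro: convexD_alt)
    moreover have "(1 - s) *\<^sub>R z + s *\<^sub>R w = A ?x + B ?y - c"
      unfolding xy xy' linear_add[OF A] linear_add[OF B] linear_scale[OF A] linear_scale[OF B]
      by (simp add: algebra_simps)
    moreover have "F ?x + G ?y - \<Phi> \<le> (1 - s) * d + s * e"
    proof -
      have "F ?x + G ?y - \<Phi> \<le> (1 - s) * (F x + G y - \<Phi>) + s * (F x' + G y' - \<Phi>)"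
        using convex_onD[OF F h(3,4) xy(1) xy'(1)] convex_onD[OF G h(3,4) xy(2) xy'(2)]
        by (simp add: algebra_simps)
      also have "\<dots> \<le> (1 - s) * d + s * e"
        using h xy(4) xy'(4) by (intro add_mono mult_left_mono) auto
      finally show ?thesis .
    qed
    ultimately show ?thesis unfolding P_def by blast
  qed
  moreover have "0 \<le> e" if "P 0 e" for e
    using that opt unfolding P_def by fastforce
  ultimately have "\<exists>\<Lambda>\<ge>0. \<forall>z e. P z e \<longrightarrow> - \<Lambda> * norm z \<le> e"
    by (rule rel_interior_zero_lower_bound)
  then show ?thesis unfolding P_def by blast
qed

subsection \<open>Convergence rates\<close>

text \<open>With weights \<open>(t + 1) * (t + 2)\<close> the recursion for \<open>V\<close>
  telescopes. Each weighted error is at most \<open>2 * K * (t + 1) powr (1 - p)\<close>, and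
  \<open>t + 1\<close> of them are summed.\<close>

lemma penalty_recursion_rate:
  fixes E r \<beta> :: "nat \<Rightarrow> real"
  assumes step: "\<And>t. E (Suc t) + \<beta> t / 2 * (r (Suc t))\<^sup>2
      \<le> (1 - 2 / (real t + 2)) * E t + \<beta> t / 2 * (1 - 2 * (2 / (real t + 2))) * (r t)\<^sup>2
        + K * (real t + 1) powr (- 1 - p)"
    and \<beta>: "\<And>t. \<beta> t = \<beta>0 * (real t + 1) powr \<delta>" "0 < \<beta>0" "0 < \<delta>" "\<delta> < 1"
    and p: "p \<le> 1" and K: "0 \<le> K"
  shows "E (Suc t) + \<beta> t / 2 * (r (Suc t))\<^sup>2 \<le> 2 * K * (real t + 1) powr (- p)"
proof -
  define V where "V t = E (Suc t) + \<beta> t / 2 * (r (Suc t))\<^sup>2" for t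
  have err: "(real t + 1) * (real t + 2) * (K * (real t + 1) powr (- 1 - p))
      \<le> 2 * K * (real t + 1) powr (1 - p)" for t
  proof -
    have "(real t + 1) * (real t + 2) * (K * (real t + 1) powr (- 1 - p))
        \<le> (real t + 1) * (2 * (real t + 1)) * (K * (real t + 1) powr (- 1 - p))"
      using K by (intro mult_right_mono mult_left_mono) auto
    also have "\<dots> = 2 * K * ((real t + 1) powr 2 * (real t + 1) powr (- 1 - p))"
      by (simp add: power2_eq_square)
    also have "(real t + 1) powr 2 * (real t + 1) powr (- 1 - p) = (real t + 1) powr (1 - p)"
      by (simp only: powr_add[symmetric]) simp
    finally show ?thesis .
  qed
  have key: "(real t + 1) * (real t + 2) * V t \<le> 2 * K * ((real t + 1) * (real t + 1) powr (1 - p))" for t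
  proof (induction t)
    case 0
    \<comment> \<open>The first step size is \<open>1\<close>, so \<open>E 0\<close> drops out and
      the penalty coefficient is negative: the starting point does not enter.\<close>
    have "V 0 \<le> - \<beta> 0 / 2 * (r 0)\<^sup>2 + K" using step[of 0] by (simp add: V_def)
    also have "\<dots> \<le> K" using \<beta>(1)[of 0] \<beta>(2) by simp
    finally show ?case by simp
  next
    case (Suc t)
    define n where "n = real t + 1"
    have n: "n \<ge> 1" "real (Suc t) = n" "real t + 1 = n" "real t + 2 = n + 1" by (auto simp: n_def)
    have "V (Suc t) \<le> (1 - 2 / (n + 2)) * E (Suc t)
        + \<beta> (Suc t) / 2 * (1 - 2 * (2 / (n + 2))) * (r (Suc t))\<^sup>2 + K * (n + 1) powr (- 1 - p)"
      using step[of "Suc t"] unfolding V_def n(2) .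
    also have "\<beta> (Suc t) / 2 * (1 - 2 * (2 / (n + 2))) * (r (Suc t))\<^sup>2
        \<le> \<beta> t / 2 * (1 - 2 / (n + 2)) * (r (Suc t))\<^sup>2"
    proof (intro mult_right_mono zero_le_power2)
      have b: "\<beta> (Suc t) = \<beta>0 * (n + 1) powr \<delta>" "\<beta> t = \<beta>0 * n powr \<delta>"
        using \<beta>(1) by (auto simp: n_def)
      \<comment> \<open>For \<open>n > 2\<close> this follows from
        \<open>(n + 1) powr \<delta> \<le> n powr \<delta> * ((n + 1) / n)\<close>, valid as
        \<open>\<delta> < 1\<close>, and \<open>(n + 1) * (n - 2) \<le> n * n\<close>.\<close>
      have "(n + 1) powr \<delta> * (n - 2) \<le> n powr \<delta> * n"
      proof (cases "n \<le> 2")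
        case True
        then have "(n + 1) powr \<delta> * (n - 2) \<le> 0" by (intro mult_nonneg_nonpos) auto
        also have "0 \<le> n powr \<delta> * n" using n by simp
        finally show ?thesis .
      next
        case False
        have "(n + 1) powr \<delta> = n powr \<delta> * ((n + 1) / n) powr \<delta>"
          using n by (simp add: powr_mult[symmetric])
        also have "\<dots> \<le> n powr \<delta> * ((n + 1) / n) powr 1"
          using n \<beta>(3,4) by (intro mult_left_mono powr_mono) auto
        finally have "(n + 1) powr \<delta> * (n - 2) \<le> n powr \<delta> * ((n + 1) / n) * (n - 2)"
          using False n by (intro mult_right_mono) auto
        also have "\<dots> = n powr \<delta> * ((n + 1) / n * (n - 2))" by simp
        also have "\<dots> \<le> n powr \<delta> * n"
          using n False by (intro mult_left_mono) (auto simp: field_simps)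
        finally show ?thesis .
      qed
      then have "\<beta>0 / 2 / (n + 2) * ((n + 1) powr \<delta> * (n - 2)) \<le> \<beta>0 / 2 / (n + 2) * (n powr \<delta> * n)"
        using \<beta>(2) n by (intro mult_left_mono) auto
      moreover have "1 - 2 * (2 / (n + 2)) = (n - 2) / (n + 2)" "1 - 2 / (n + 2) = n / (n + 2)"
        using n by (auto simp: field_simps)
      ultimately show "\<beta> (Suc t) / 2 * (1 - 2 * (2 / (n + 2))) \<le> \<beta> t / 2 * (1 - 2 / (n + 2))"
        unfolding b by (simp add: mult_ac)
    qed
    also have "(1 - 2 / (n + 2)) * E (Suc t) + \<beta> t / 2 * (1 - 2 / (n + 2)) * (r (Suc t))\<^sup>2
          + K * (n + 1) powr (- 1 - p)
        = n / (n + 2) * V t + K * (n + 1) powr (- 1 - p)"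
    proof -
      have "1 - 2 / (n + 2) = n / (n + 2)" using n by (auto simp: field_simps)
      then show ?thesis unfolding V_def by (simp only: distrib_left) (simp add: mult_ac)
    qed
    finally have "(n + 1) * (n + 2) * V (Suc t)
        \<le> (n + 1) * (n + 2) * (n / (n + 2) * V t + K * (n + 1) powr (- 1 - p))"
      using n by (intro mult_left_mono) auto
    also have "\<dots> = n * (n + 1) * V t + (n + 1) * (n + 2) * (K * (n + 1) powr (- 1 - p))"
      using n by (simp add: field_simps)
    also have "\<dots> \<le> 2 * K * (n * n powr (1 - p)) + 2 * K * (n + 1) powr (1 - p)"
      using Suc[unfolded n(3,4)] err[of "Suc t", unfolded n(2)] by (rule add_mono)
    \<comment> \<open>The \<open>n\<close> earlier error terms are replaced by the newest, largest
      one, which is where \<open>p \<le> 1\<close> enters.\<close>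
    also have "\<dots> \<le> 2 * K * (n * (n + 1) powr (1 - p)) + 2 * K * (n + 1) powr (1 - p)"
      using K n p by (intro add_right_mono mult_left_mono powr_mono2) auto
    also have "\<dots> = 2 * K * ((n + 1) * (n + 1) powr (1 - p))" by (simp add: algebra_simps)
    finally show ?case unfolding n(2) .
  qed
  define n where "n = real t + 1"
  have n: "n \<ge> 1" by (simp add: n_def)
  have "n * ((n + 1) * V t) \<le> n * (2 * K * n powr (1 - p))"
    using key[of t] by (simp add: n_def add_ac mult_ac)
  then have "(n + 1) * V t \<le> 2 * K * n powr (1 - p)" using n by simp
  also have "n powr (1 - p) = n * n powr (- p)" using n by (simp add: powr_diff powr_minus_divide)
  also have "2 * K * (n * n powr (- p)) \<le> (n + 1) * (2 * K * n powr (- p))"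
    using K n by (simp add: algebra_simps)
  finally show ?thesis using n by (simp add: V_def n_def)
qed

text \<open>The penalty weight \<open>n powr (1 - p)\<close> against the right-hand side
  \<open>n powr (- p)\<close> suggests \<open>\<rho>\<^sup>2\<close> of order \<open>1 / n\<close>
  whatever \<open>p\<close> is. Inserting the lower bound on \<open>e\<close> gives a quadratic
  inequality for \<open>s = \<rho> * n powr (1 / 2)\<close>; its linear term is controlled because
  \<open>p \<le> 1 / 2\<close>.\<close>

lemma penalty_rate_imp_residual_rate:
  fixes n \<rho> e K \<beta>0 p \<Lambda> :: real
  assumes n: "1 \<le> n" and rate: "e + \<beta>0 * n powr (1 - p) / 2 * \<rho>\<^sup>2 \<le> K * n powr (- p)"
    and lower: "- \<Lambda> * \<rho> \<le> e" and nonneg: "0 < \<beta>0" "0 \<le> \<rho>" "0 \<le> \<Lambda>" "0 \<le> K" and p: "p \<le> 1 / 2"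
  defines "S \<equiv> 1 + 2 * (K + \<Lambda>) / \<beta>0"
  shows "\<rho> \<le> S * n powr (- (1 / 2))" and "\<bar>e\<bar> \<le> (K + \<Lambda> * S) * n powr (- p)"
proof -
  have S: "S \<ge> 1" using nonneg by (simp add: S_def)
  define s where "s = \<rho> * n powr (1 / 2)"
  have s: "0 \<le> s" "s\<^sup>2 = \<rho>\<^sup>2 * n"
    using nonneg n by (auto simp: s_def power_mult_distrib powr_half_sqrt)
  have "n powr p * (\<beta>0 * n powr (1 - p) / 2 * \<rho>\<^sup>2) \<le> n powr p * (K * n powr (- p) + \<Lambda> * \<rho>)"
    using rate lower by (intro mult_left_mono) auto
  also have "n powr p * (\<beta>0 * n powr (1 - p) / 2 * \<rho>\<^sup>2) = \<beta>0 / 2 * \<rho>\<^sup>2 * (n powr p * n powr (1 - p))"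
    by simp
  also have "n powr p * n powr (1 - p) = n"
    using n by (simp add: powr_add[symmetric])
  also have "n powr p * (K * n powr (- p) + \<Lambda> * \<rho>) = K * (n powr p * n powr (- p)) + \<Lambda> * (\<rho> * n powr p)"
    by (simp add: algebra_simps)
  also have "n powr p * n powr (- p) = 1"
    using n by (simp add: powr_add[symmetric])
  also have "\<Lambda> * (\<rho> * n powr p) \<le> \<Lambda> * s"
    unfolding s_def using n p nonneg by (intro mult_left_mono powr_mono) auto
  finally have quad: "\<beta>0 / 2 * s\<^sup>2 \<le> K + \<Lambda> * s" by (simp add: s mult_ac)
  have "s \<le> S"
  proof (cases "s \<le> 1")
    case True
    then show ?thesis using S by simp
  next
    case False
    have "\<beta>0 / 2 * s\<^sup>2 \<le> K * s + \<Lambda> * s"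
      using quad mult_left_mono[of 1 s K] False nonneg(4) by simp
    then have "s * (\<beta>0 / 2 * s) \<le> s * (K + \<Lambda>)" by (simp add: power2_eq_square algebra_simps)
    then have "\<beta>0 / 2 * s \<le> K + \<Lambda>" using False by simp
    then have "s \<le> 2 * (K + \<Lambda>) / \<beta>0" using nonneg by (simp add: field_simps)
    then show ?thesis by (simp add: S_def)
  qed
  have "\<rho> = s * n powr (- (1 / 2))"
    using n by (simp add: s_def mult.assoc powr_add[symmetric])
  also have "\<dots> \<le> S * n powr (- (1 / 2))" using \<open>s \<le> S\<close> by (intro mult_right_mono) auto
  finally show \<rho>: "\<rho> \<le> S * n powr (- (1 / 2))" .
  have "n powr (- (1 / 2)) \<le> n powr (- p)" using n p by (intro powr_mono) auto
  then have "S * n powr (- (1 / 2)) \<le> S * n powr (- p)" using S by (intro mult_left_mono) auto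
  with \<rho> have "\<Lambda> * \<rho> \<le> \<Lambda> * (S * n powr (- p))" using nonneg by (intro mult_left_mono) auto
  moreover have "0 \<le> \<beta>0 * n powr (1 - p) / 2 * \<rho>\<^sup>2" using nonneg by simp
  moreover have "0 \<le> K * n powr (- p)" "0 \<le> \<Lambda> * (S * n powr (- p))"
    using nonneg S by auto
  ultimately show "\<bar>e\<bar> \<le> (K + \<Lambda> * S) * n powr (- p)"
    using rate lower unfolding distrib_right by (simp add: mult.assoc)
qed

section \<open>Decay of the error terms of one iteration\<close>

text \<open>The threshold is \<open>s = 1 / n\<close>: below it the constant term dominates, above
  it \<open>(n * s) powr (1 - \<mu>)\<close> is at least \<open>1\<close> and raises the power to a
  square.\<close>

lemma powr_le_power2_scale:
  fixes s n \<mu> :: real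
  assumes "0 < n" "0 \<le> s" "0 < \<mu>" "\<mu> \<le> 1"
  shows "s powr (\<mu> + 1) \<le> n powr (1 - \<mu>) * s\<^sup>2 + n powr (- 1 - \<mu>)"
proof (cases "n * s \<le> 1")
  case True
  then have "s \<le> n powr (- 1)" using assms by (simp add: powr_minus_divide field_simps)
  then have "s powr (\<mu> + 1) \<le> (n powr (- 1)) powr (\<mu> + 1)"
    using assms by (intro powr_mono2) auto
  also have "\<dots> = n powr (- 1 - \<mu>)" by (simp only: powr_powr) (simp add: algebra_simps)
  finally show ?thesis by (simp add: add_increasing)
next
  case False
  then have s: "s > 0" using assms by (cases "s = 0") auto
  have "1 \<le> (n * s) powr (1 - \<mu>)" using False assms by (intro ge_one_powr_ge_zero) auto
  then have "s powr (\<mu> + 1) * 1 \<le> s powr (\<mu> + 1) * (n * s) powr (1 - \<mu>)"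
    by (intro mult_left_mono) auto
  also have "\<dots> = n powr (1 - \<mu>) * (s powr (\<mu> + 1) * s powr (1 - \<mu>))"
    using assms by (simp add: powr_mult)
  also have "s powr (\<mu> + 1) * s powr (1 - \<mu>) = s\<^sup>2"
    using s by (simp add: powr_add[symmetric])
  finally show ?thesis by (simp add: add_increasing2)
qed

text \<open>\<open>H\<close> is chosen so that its quadratic term absorbs the one produced by
  \<open>powr_le_power2_scale\<close>, leaving a remainder of order
  \<open>n powr (- 1 - \<mu>)\<close>.\<close>

lemma hoelder_error_bound:
  fixes H :: "nat \<Rightarrow> real"
  assumes H0: "0 < H 0"
    and H: "\<And>t. H (Suc t) = max (H 0) (2 * M / (\<mu> + 1)) * (real t + 1) powr (1 - \<mu>)"
    and \<mu>: "0 < \<mu>" "\<mu> \<le> 1" "p \<le> \<mu>" and M: "0 \<le> M" and s: "0 \<le> s" "s \<le> D"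
  shows "M / (\<mu> + 1) * s powr (\<mu> + 1) - H t / 2 * s\<^sup>2
    \<le> M / (\<mu> + 1) * (4 + D powr (\<mu> + 1)) * (real t + 1) powr (- 1 - p)"
proof (cases t)
  case 0
  \<comment> \<open>\<open>H 0\<close> is an arbitrary positive number unrelated to
    \<open>M\<close>, so at time \<open>0\<close> only the diameter bounds the error.\<close>
  have "M / (\<mu> + 1) * s powr (\<mu> + 1) \<le> M / (\<mu> + 1) * (4 + D powr (\<mu> + 1))"
    using s \<mu> M powr_mono2[of "\<mu> + 1" s D] by (intro mult_left_mono) auto
  moreover have "0 \<le> H t / 2 * s\<^sup>2" using H0 0 by simp
  ultimately show ?thesis using 0 by simp
next
  case (Suc k)
  define n where "n = real k + 1"
  have n: "n \<ge> 1" "real t = n" by (auto simp: n_def Suc)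
  define m where "m = M / (\<mu> + 1)"
  have m: "m \<ge> 0" using M \<mu> by (simp add: m_def)
  have "m * s powr (\<mu> + 1) \<le> m * (n powr (1 - \<mu>) * s\<^sup>2 + n powr (- 1 - \<mu>))"
    using n s \<mu> m by (intro mult_left_mono powr_le_power2_scale) auto
  moreover have "m * (n powr (1 - \<mu>) * s\<^sup>2) \<le> H t / 2 * s\<^sup>2"
  proof -
    have "2 * m * n powr (1 - \<mu>) \<le> H t"
      unfolding Suc H n_def[symmetric] m_def by (intro mult_right_mono) auto
    then have "m * n powr (1 - \<mu>) * s\<^sup>2 \<le> H t / 2 * s\<^sup>2" by (intro mult_right_mono) auto
    then show ?thesis by (simp add: mult.assoc)
  qed
  moreover have "m * n powr (- 1 - \<mu>) \<le> m * (4 * (n + 1) powr (- 1 - p))"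
  proof (intro mult_left_mono m)
    \<comment> \<open>Here \<open>n\<close> is \<open>t\<close>, while the claim is in terms of
      \<open>t + 1\<close>; the shift costs the factor
      \<open>2 powr (1 + \<mu>) \<le> 4\<close>.\<close>
    have "n powr (- 1 - \<mu>) \<le> ((n + 1) / 2) powr (- 1 - \<mu>)"
      using n \<mu> by (intro powr_mono2') auto
    also have "\<dots> = (n + 1) powr (- 1 - \<mu>) * 2 powr (1 + \<mu>)"
      using n powr_minus[of 2 "1 + \<mu>"] by (simp add: powr_divide field_simps)
    also have "\<dots> \<le> (n + 1) powr (- 1 - p) * 2 powr 2"
      using n \<mu> by (intro mult_mono powr_mono) auto
    finally show "n powr (- 1 - \<mu>) \<le> 4 * (n + 1) powr (- 1 - p)" by simp
  qed
  moreover have "m * (4 * (n + 1) powr (- 1 - p)) \<le> m * (4 + D powr (\<mu> + 1)) * (n + 1) powr (- 1 - p)"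
    unfolding mult.assoc using m by (intro mult_left_mono mult_right_mono) auto
  ultimately show ?thesis unfolding m_def[symmetric] n by (simp add: distrib_left)
qed

text \<open>A squared step size of order \<open>n powr (- 2)\<close> meets a weight of order
  \<open>n powr (1 - p)\<close>.\<close>

lemma step_size_error_bound:
  assumes q: "0 \<le> q" "q \<le> C * (real t + 1) powr (1 - p)" and w: "0 \<le> w" "w \<le> W"
  shows "q / 2 * (2 / (real t + 2))\<^sup>2 * w \<le> 2 * C * W * (real t + 1) powr (- 1 - p)"
proof -
  define n where "n = real t + 1"
  have n: "n \<ge> 1" by (simp add: n_def)
  have "2 / (real t + 2) \<le> 2 / n" by (intro divide_left_mono) (auto simp: n_def)
  then have "(2 / (real t + 2))\<^sup>2 \<le> (2 / n)\<^sup>2" by (intro power_mono) auto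
  also have "(2 / n)\<^sup>2 = 4 * n powr (- 2)"
    using n by (simp add: powr_minus_divide power_divide)
  finally have "q / 2 * (2 / (real t + 2))\<^sup>2 * w \<le> (C * n powr (1 - p)) / 2 * (4 * n powr (- 2)) * W"
    using q w by (intro mult_mono divide_right_mono mult_nonneg_nonneg) (auto simp: n_def)
  also have "\<dots> = 2 * C * W * (n powr (1 - p) * n powr (- 2))" by simp
  also have "n powr (1 - p) * n powr (- 2) = n powr (- 1 - p)"
    by (simp only: powr_add[symmetric]) simp
  finally show ?thesis by (simp add: n_def)
qed

lemma step_size_powr_error_bound:
  assumes "0 \<le> s" "s \<le> D" "0 < \<nu>" "p \<le> \<nu>" "0 \<le> m"
  shows "m * (2 / (real t + 2) * s) powr (\<nu> + 1) \<le> m * (2 * D) powr (\<nu> + 1) * (real t + 1) powr (- 1 - p)"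
proof -
  define n where "n = real t + 1"
  have n: "n \<ge> 1" by (simp add: n_def)
  have "2 / (real t + 2) * s \<le> 2 / n * D"
    using assms n by (intro mult_mono divide_left_mono) (auto simp: n_def)
  then have "(2 / (real t + 2) * s) powr (\<nu> + 1) \<le> (2 / n * D) powr (\<nu> + 1)"
    using assms by (intro powr_mono2) auto
  also have "2 / n * D = 2 * D * n powr (- 1)" using n by (simp add: powr_minus_divide)
  also have "(2 * D * n powr (- 1)) powr (\<nu> + 1) = (2 * D) powr (\<nu> + 1) * n powr (- 1 - \<nu>)"
    using assms n by (simp only: powr_mult powr_powr) (simp add: algebra_simps)
  also have "\<dots> \<le> (2 * D) powr (\<nu> + 1) * n powr (- 1 - p)"
    using assms n by (intro mult_left_mono powr_mono) auto
  finally have "m * (2 / (real t + 2) * s) powr (\<nu> + 1) \<le> m * ((2 * D) powr (\<nu> + 1) * n powr (- 1 - p))"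
    using assms by (intro mult_left_mono)
  then show ?thesis by (simp add: n_def mult.assoc)
qed

section \<open>The rates for real-valued data\<close>

text \<open>The common exponent \<open>p\<close>, at most \<open>1 / 2\<close>, \<open>\<mu>\<close>
  and \<open>\<nu>\<close>, lets one argument serve both cases of the theorem.\<close>

lemma conditional_gradient_penalty_rates:
  fixes A :: "'a::euclidean_space \<Rightarrow> 'c::euclidean_space"
    and B :: "'b::euclidean_space \<Rightarrow> 'c"
    and x :: "nat \<Rightarrow> 'a" and y u :: "nat \<Rightarrow> 'b" and \<beta> H :: "nat \<Rightarrow> real"
  assumes A: "linear A" and B: "linear B"
    and f2: "convex_on X f2" and g2: "convex_on Y g2"
    and f1: "convex_on UNIV f1" "\<And>z. GDERIV f1 z :> grad_f1 z"
    and g1: "convex_on UNIV g1" "\<And>z. GDERIV g1 z :> grad_g1 z"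
    and Df: "\<And>v w. v \<in> X \<Longrightarrow> w \<in> X \<Longrightarrow> norm (v - w) \<le> Df"
    and Dg: "\<And>v w. v \<in> Y \<Longrightarrow> w \<in> Y \<Longrightarrow> norm (v - w) \<le> Dg"
    and smooth_f: "\<And>z w. z \<in> X \<Longrightarrow> w \<in> X \<Longrightarrow>
      f1 w \<le> f1 z + grad_f1 z \<bullet> (w - z) + Mf / (\<mu> + 1) * norm (w - z) powr (\<mu> + 1)"
    and smooth_g: "\<And>z w. z \<in> Y \<Longrightarrow> w \<in> Y \<Longrightarrow>
      g1 w \<le> g1 z + grad_g1 z \<bullet> (w - z) + Mg / (\<nu> + 1) * norm (w - z) powr (\<nu> + 1)"
    and M: "0 \<le> Mf" "0 \<le> Mg"
    and exps: "0 < \<mu>" "\<mu> \<le> 1" "0 < \<nu>" "\<nu> \<le> 1" "p \<le> \<mu>" "p \<le> \<nu>" "0 < p" "p \<le> 1 / 2"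
    and cq: "c \<in> A ` rel_interior X + B ` rel_interior Y"
    and opt: "\<And>v w. v \<in> X \<Longrightarrow> w \<in> Y \<Longrightarrow> A v + B w = c \<Longrightarrow>
      f1 xs + f2 xs + (g1 ys + g2 ys) \<le> f1 v + f2 v + (g1 w + g2 w)"
    and sol: "xs \<in> X" "ys \<in> Y" "A xs + B ys = c"
    and iter: "\<And>t. x t \<in> X" "\<And>t. y t \<in> Y" "\<And>t. u t \<in> Y"
    and x_min: "\<And>t z. z \<in> X \<Longrightarrow>
      (grad_f1 (x t) + \<beta> t *\<^sub>R adjoint A (A (x t) + B (y t) - c)) \<bullet> (x (Suc t) - x t)
        + (H t + lambda_max (adjoint A \<circ> A) * \<beta> t) / 2 * (norm (x (Suc t) - x t))\<^sup>2 + f2 (x (Suc t))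
      \<le> (grad_f1 (x t) + \<beta> t *\<^sub>R adjoint A (A (x t) + B (y t) - c)) \<bullet> (z - x t)
        + (H t + lambda_max (adjoint A \<circ> A) * \<beta> t) / 2 * (norm (z - x t))\<^sup>2 + f2 z"
    and u_min: "\<And>t z. z \<in> Y \<Longrightarrow>
      (grad_g1 (y t) + \<beta> t *\<^sub>R adjoint B (A (x (Suc t)) + B (y t) - c)) \<bullet> u t + g2 (u t)
      \<le> (grad_g1 (y t) + \<beta> t *\<^sub>R adjoint B (A (x (Suc t)) + B (y t) - c)) \<bullet> z + g2 z"
    and y_step: "\<And>t. y (Suc t) = y t + (2 / (real t + 2)) *\<^sub>R (u t - y t)"
    and H: "0 < H 0"
      "\<And>t. H (Suc t) = max (H 0) (2 * Mf / (\<mu> + 1)) * (real t + 1) powr (1 - \<mu>)"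
    and \<beta>: "0 < \<beta>0" "\<And>t. \<beta> t = \<beta>0 * (real t + 1) powr (1 - p)"
  shows "\<exists>C. \<forall>t.
    \<bar>f1 (x (Suc t)) + f2 (x (Suc t)) + (g1 (y (Suc t)) + g2 (y (Suc t)))
        - (f1 xs + f2 xs + (g1 ys + g2 ys))\<bar> \<le> C * (real t + 1) powr (- p)
    \<and> norm (A (x (Suc t)) + B (y (Suc t)) - c) \<le> C * (real t + 1) powr (- (1 / 2))"
proof -
  define l where "l = lambda_max (adjoint A \<circ> A)"
  have l: "0 \<le> l" "\<And>v. (norm (A v))\<^sup>2 \<le> l * (norm v)\<^sup>2"
    using lambda_max_nonneg[OF A] norm_le_lambda_max[OF A] by (auto simp: l_def)
  obtain k where k: "k > 0" "\<And>v. norm (B v) \<le> k * norm v"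
    using linear_bounded_pos[OF B] by blast
  define F where "F v = f1 v + f2 v" for v
  define G where "G w = g1 w + g2 w" for w
  have D: "0 \<le> Df" "0 \<le> Dg" using Df[OF sol(1,1)] Dg[OF sol(2,2)] by auto
  have sq_f: "(norm (v - w))\<^sup>2 \<le> Df\<^sup>2" if "v \<in> X" "w \<in> X" for v w
    using Df[OF that] by (intro power_mono) auto
  have sq_B: "(norm (B (v - w)))\<^sup>2 \<le> (k * Dg)\<^sup>2" if "v \<in> Y" "w \<in> Y" for v w
    using k Dg[OF that] by (intro power_mono order.trans[OF k(2)] mult_left_mono) auto
  define E where "E t = F (x t) + G (y t) - (F xs + G ys)" for t
  define r where "r t = norm (A (x t) + B (y t) - c)" for t
  define Hb where "Hb = max (H 0) (2 * Mf / (\<mu> + 1))"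
  have H_pos: "0 < H t" for t
    using H(1) by (cases t) (auto simp: H(2) less_max_iff_disj)
  have \<beta>_pos: "0 < \<beta> t" for t using \<beta> by simp
  \<comment> \<open>As \<open>p \<le> \<mu>\<close>, \<open>H\<close> grows no faster than
    \<open>\<beta>\<close>, so both parts of the prox weight obey one bound.\<close>
  have H_le: "H t \<le> Hb * (real t + 1) powr (1 - p)" for t
  proof (cases t)
    case 0
    then show ?thesis by (simp add: Hb_def)
  next
    case (Suc j)
    have "(real j + 1) powr (1 - \<mu>) \<le> (real t + 1) powr (1 - \<mu>)"
      using Suc exps by (intro powr_mono2) auto
    also have "\<dots> \<le> (real t + 1) powr (1 - p)" using exps by (intro powr_mono) auto
    finally show ?thesis
      using H(1) unfolding Suc H(2) Hb_def by (intro mult_left_mono) auto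
  qed
  \<comment> \<open>In order: the prox weight at the comparison point, the Hoelder remainders of
    \<open>f1\<close> and \<open>g1\<close>, the penalty curvature along \<open>u t - y t\<close>,
    and the coupling terms of \<open>penalty_descent\<close>.\<close>
  define K1 where "K1 = 2 * (Hb + l * \<beta>0) * Df\<^sup>2"
  define K2 where "K2 = Mf / (\<mu> + 1) * (4 + Df powr (\<mu> + 1))"
  define K3 where "K3 = Mg / (\<nu> + 1) * (2 * Dg) powr (\<nu> + 1)"
  define K4 where "K4 = 2 * \<beta>0 * (k * Dg)\<^sup>2"
  define K5 where "K5 = 2 * \<beta>0 * (l * Df\<^sup>2 + 2 * (k * Dg)\<^sup>2)"
  define K where "K = K1 + K2 + K3 + K4 + K5"
  have K: "0 \<le> K"
    unfolding K_def K1_def K2_def K3_def K4_def K5_def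
    using H(1) l(1) \<beta>(1) M exps by (intro add_nonneg_nonneg mult_nonneg_nonneg) (auto simp: Hb_def)
  have step: "E (Suc t) + \<beta> t / 2 * (r (Suc t))\<^sup>2
      \<le> (1 - 2 / (real t + 2)) * E t + \<beta> t / 2 * (1 - 2 * (2 / (real t + 2))) * (r t)\<^sup>2
        + K * (real t + 1) powr (- 1 - p)" for t
  proof -
    define a where "a = 2 / (real t + 2)"
    have a: "0 \<le> a" "a \<le> 1" by (auto simp: a_def)
    define n where "n = (real t + 1) powr (- 1 - p)"
    let ?s = "norm (x (Suc t) - x t)"
    have Lnn: "0 \<le> H t + l * \<beta> t" using H_pos[of t] \<beta>_pos[of t] l by simp
    have x_step: "F (x (Suc t)) + \<beta> t / 2 * (norm (A (x (Suc t)) + (B (y t) - c)))\<^sup>2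
        + (H t + l * \<beta> t) / 2 * (norm (x (Suc t) - (x t + a *\<^sub>R (xs - x t))))\<^sup>2
      \<le> (1 - a) * F (x t) + a * F xs + \<beta> t / 2 * (norm (A (x t) + (B (y t) - c)))\<^sup>2
        + \<beta> t * a * ((A (x t) + (B (y t) - c)) \<bullet> A (xs - x t))
        + (H t + l * \<beta> t) / 2 * a\<^sup>2 * (norm (xs - x t))\<^sup>2
        + (Mf / (\<mu> + 1) * ?s powr (\<mu> + 1) - H t / 2 * ?s\<^sup>2)"
      unfolding F_def
    proof (rule proximal_step[OF A l(2) f2 iter(1) iter(1) sol(1) a])
      show "f1 (x t) + grad_f1 (x t) \<bullet> (xs - x t) \<le> f1 xs"
        by (rule gderiv_convex_above_tangent[OF f1])
      show "0 \<le> \<beta> t" using \<beta>_pos[of t] by simp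
      show "(grad_f1 (x t) + \<beta> t *\<^sub>R adjoint A (A (x t) + (B (y t) - c))) \<bullet> (x (Suc t) - x t)
          + (H t + l * \<beta> t) / 2 * (norm (x (Suc t) - x t))\<^sup>2 + f2 (x (Suc t))
        \<le> (grad_f1 (x t) + \<beta> t *\<^sub>R adjoint A (A (x t) + (B (y t) - c))) \<bullet> (z - x t)
          + (H t + l * \<beta> t) / 2 * (norm (z - x t))\<^sup>2 + f2 z" if "z \<in> X" for z
        using x_min[OF that, of t] by (simp add: l_def add_diff_eq)
    qed (rule smooth_f[OF iter(1) iter(1)])
    have y_step': "G (y (Suc t)) + \<beta> t / 2 * (norm (B (y (Suc t)) + (A (x (Suc t)) - c)))\<^sup>2
      \<le> (1 - a) * G (y t) + a * G ys + \<beta> t / 2 * (norm (B (y t) + (A (x (Suc t)) - c)))\<^sup>2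
        + \<beta> t * a * ((B (y t) + (A (x (Suc t)) - c)) \<bullet> B (ys - y t))
        + (Mg / (\<nu> + 1) * norm (y (Suc t) - y t) powr (\<nu> + 1)
            + \<beta> t / 2 * a\<^sup>2 * (norm (B (u t - y t)))\<^sup>2)"
      unfolding G_def
    proof (rule conditional_gradient_step[OF B g2 iter(3) iter(2) a])
      show "g1 (y t) + grad_g1 (y t) \<bullet> (ys - y t) \<le> g1 ys"
        by (rule gderiv_convex_above_tangent[OF g1])
      show "y (Suc t) = y t + a *\<^sub>R (u t - y t)" by (simp add: y_step a_def)
      have "B (y t) + (A (x (Suc t)) - c) = A (x (Suc t)) + B (y t) - c" by simp
      then show "(grad_g1 (y t) + \<beta> t *\<^sub>R adjoint B (B (y t) + (A (x (Suc t)) - c))) \<bullet> u t + g2 (u t)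
        \<le> (grad_g1 (y t) + \<beta> t *\<^sub>R adjoint B (B (y t) + (A (x (Suc t)) - c))) \<bullet> ys + g2 ys"
        using u_min[OF sol(2), of t] by (simp only:)
    qed (rule smooth_g[OF iter(2) iter(2)])
    have "F (x (Suc t)) + G (y (Suc t)) - (F xs + G ys) + \<beta> t / 2 * (r (Suc t))\<^sup>2
      \<le> (1 - a) * (F (x t) + G (y t) - (F xs + G ys)) + \<beta> t / 2 * (1 - 2 * a) * (r t)\<^sup>2
        + (H t + l * \<beta> t) / 2 * a\<^sup>2 * (norm (xs - x t))\<^sup>2
        + (Mf / (\<mu> + 1) * ?s powr (\<mu> + 1) - H t / 2 * ?s\<^sup>2)
        + (Mg / (\<nu> + 1) * norm (y (Suc t) - y t) powr (\<nu> + 1)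
            + \<beta> t / 2 * a\<^sup>2 * (norm (B (u t - y t)))\<^sup>2)
        + \<beta> t / 2 * a\<^sup>2 * (l * (norm (xs - x t))\<^sup>2 + 2 * (norm (B (ys - y t)))\<^sup>2)"
      unfolding r_def
      by (rule penalty_descent[OF A l(2) B _ _ sol(3) x_step y_step'])
        (use \<beta>_pos[of t] H_pos[of t] in auto)
    moreover have "(H t + l * \<beta> t) / 2 * a\<^sup>2 * (norm (xs - x t))\<^sup>2 \<le> K1 * n"
      unfolding K1_def n_def a_def
    proof (rule step_size_error_bound)
      show "H t + l * \<beta> t \<le> (Hb + l * \<beta>0) * (real t + 1) powr (1 - p)"
        using H_le[of t] by (simp add: \<beta>(2) distrib_right mult.assoc)
    qed (use Lnn sq_f[OF sol(1) iter(1)] in auto)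
    moreover have "Mf / (\<mu> + 1) * ?s powr (\<mu> + 1) - H t / 2 * ?s\<^sup>2 \<le> K2 * n"
      unfolding K2_def n_def
      using exps M Df[OF iter(1) iter(1)] by (intro hoelder_error_bound H) auto
    moreover have "Mg / (\<nu> + 1) * norm (y (Suc t) - y t) powr (\<nu> + 1) \<le> K3 * n"
    proof -
      have "norm (y (Suc t) - y t) = 2 / (real t + 2) * norm (u t - y t)"
        by (simp add: y_step)
      then show ?thesis unfolding K3_def n_def
        using exps M Dg[OF iter(3,2)] by (simp only:) (intro step_size_powr_error_bound, auto)
    qed
    moreover have "\<beta> t / 2 * a\<^sup>2 * (norm (B (u t - y t)))\<^sup>2 \<le> K4 * n"
      unfolding K4_def n_def a_def
      using \<beta>(1) sq_B[OF iter(3,2)] by (intro step_size_error_bound) (auto simp: \<beta>(2))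
    moreover have "\<beta> t / 2 * a\<^sup>2 * (l * (norm (xs - x t))\<^sup>2 + 2 * (norm (B (ys - y t)))\<^sup>2) \<le> K5 * n"
      unfolding K5_def n_def a_def
    proof (rule step_size_error_bound)
      show "l * (norm (xs - x t))\<^sup>2 + 2 * (norm (B (ys - y t)))\<^sup>2 \<le> l * Df\<^sup>2 + 2 * (k * Dg)\<^sup>2"
        using l(1) sq_f[OF sol(1) iter(1)] sq_B[OF sol(2) iter(2)] by (intro add_mono mult_left_mono) auto
    qed (use \<beta>(1) l(1) in \<open>auto simp: \<beta>(2)\<close>)
    moreover have "K * n = K1 * n + K2 * n + K3 * n + K4 * n + K5 * n"
      by (simp add: K_def distrib_right)
    ultimately show ?thesis unfolding E_def a_def[symmetric] n_def[symmetric] by linarith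
  qed
  have "convex_on X F" unfolding F_def
    using convex_on_subset[OF f1(1)] f2 convex_on_imp_convex[OF f2] by (intro convex_on_add) auto
  moreover have "convex_on Y G" unfolding G_def
    using convex_on_subset[OF g1(1)] g2 convex_on_imp_convex[OF g2] by (intro convex_on_add) auto
  ultimately obtain \<Lambda> where \<Lambda>: "0 \<le> \<Lambda>"
    "\<And>v w. v \<in> X \<Longrightarrow> w \<in> Y \<Longrightarrow> - \<Lambda> * norm (A v + B w - c) \<le> F v + G w - (F xs + G ys)"
    using constraint_qualification_error_bound[OF A B _ _ cq, of F G "F xs + G ys"] opt
    unfolding F_def G_def by blast
  define S where "S = 1 + 2 * (2 * K + \<Lambda>) / \<beta>0"
  have "\<bar>E (Suc t)\<bar> \<le> max (2 * K + \<Lambda> * S) S * (real t + 1) powr (- p)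
      \<and> r (Suc t) \<le> max (2 * K + \<Lambda> * S) S * (real t + 1) powr (- (1 / 2))" for t
  proof -
    have "E (Suc t) + \<beta> t / 2 * (r (Suc t))\<^sup>2 \<le> 2 * K * (real t + 1) powr (- p)"
      using exps by (intro penalty_recursion_rate[OF step \<beta>(2,1) _ _ _ K]) auto
    then have rate: "E (Suc t) + \<beta>0 * (real t + 1) powr (1 - p) / 2 * (r (Suc t))\<^sup>2
        \<le> 2 * K * (real t + 1) powr (- p)" by (simp add: \<beta>)
    have lower: "- \<Lambda> * r (Suc t) \<le> E (Suc t)"
      unfolding r_def E_def by (rule \<Lambda>(2)[OF iter(1,2)])
    have "1 \<le> real t + 1" "0 \<le> r (Suc t)" "0 \<le> 2 * K" using K by (auto simp: r_def)
    note bounds = penalty_rate_imp_residual_rate[OF this(1) rate lower \<beta>(1) this(2) \<Lambda>(1) this(3) exps(8),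
        folded S_def]
    have "(2 * K + \<Lambda> * S) * (real t + 1) powr (- p) \<le> max (2 * K + \<Lambda> * S) S * (real t + 1) powr (- p)"
      "S * (real t + 1) powr (- (1 / 2)) \<le> max (2 * K + \<Lambda> * S) S * (real t + 1) powr (- (1 / 2))"
      by (intro mult_right_mono; simp)+
    with bounds show ?thesis by linarith
  qed
  then show ?thesis unfolding E_def r_def F_def G_def by blast
qed

section \<open>Passage to the asymptotic, extended-valued statement\<close>

text \<open>Shifting the index by one costs at most the factor \<open>2 powr q \<le> 2\<close>, as
  \<open>j + 2 \<le> 2 * (j + 1)\<close>.\<close>

lemma bigo_powr_minusI:
  fixes d :: "nat \<Rightarrow> real"
  assumes bound: "\<And>t. \<bar>d (Suc t)\<bar> \<le> C * (real t + 1) powr (- q)" and q: "0 \<le> q" "q \<le> 1"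
  shows "d \<in> O(\<lambda>t. (real t + 1) powr (- q))"
proof (rule bigoI)
  have C: "0 \<le> C" using order.trans[OF abs_ge_zero bound[of 0]] by simp
  have "norm (d t) \<le> 2 * C * norm ((real t + 1) powr (- q))" if "t \<ge> 1" for t
  proof -
    obtain j where t: "t = Suc j" using \<open>t \<ge> 1\<close> by (cases t) auto
    have "(real j + 1) powr (- q) \<le> ((real t + 1) / 2) powr (- q)"
      using q by (intro powr_mono2') (auto simp: t)
    also have "\<dots> = (real t + 1) powr (- q) * 2 powr q"
      using powr_minus[of 2 q] by (simp add: powr_divide field_simps)
    also have "\<dots> \<le> (real t + 1) powr (- q) * 2 powr 1"
      using q by (intro mult_left_mono powr_mono) auto
    finally have "C * (real j + 1) powr (- q) \<le> C * ((real t + 1) powr (- q) * 2)"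
      using C by (intro mult_left_mono) auto
    with bound[of j] show ?thesis by (simp add: t mult_ac)
  qed
  then show "\<forall>\<^sub>F t in at_top. norm (d t) \<le> 2 * C * norm ((real t + 1) powr (- q))"
    using eventually_at_top_linorder by blast
qed

theorem mainTheorem3:
  fixes A :: "'a::euclidean_space \<Rightarrow> 'c::euclidean_space"
    and B :: "'b::euclidean_space \<Rightarrow> 'c"
    and c :: 'c
    and f f2 :: "'a \<Rightarrow> ereal" and g g2 :: "'b \<Rightarrow> ereal"
    and f1 :: "'a \<Rightarrow> real" and g1 :: "'b \<Rightarrow> real"
    and grad_f1 :: "'a \<Rightarrow> 'a" and grad_g1 :: "'b \<Rightarrow> 'b"
    and \<mu> \<nu> Mf Mg \<delta> :: real
    and x :: "nat \<Rightarrow> 'a" and y u :: "nat \<Rightarrow> 'b"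
    and R R' :: "nat \<Rightarrow> 'c"
    and \<beta> H :: "nat \<Rightarrow> real"
    and xs :: 'a and ys :: 'b
  (* problem (P) *)
  assumes "linear A" and "linear B"
    and "proper_closed_convex f" and "proper_closed_convex g"
  (* Assumption (D) *)
    and "dom_diameter f < \<infinity>" and "dom_diameter g < \<infinity>"
  (* Assumption (S) *)
    and "\<And>z. f z = ereal (f1 z) + f2 z" and "\<And>z. g z = ereal (g1 z) + g2 z"
    and "convex_on UNIV f1" and "convex_on UNIV g1"
    and "\<And>z. GDERIV f1 z :> grad_f1 z" and "\<And>z. GDERIV g1 z :> grad_g1 z"
    and "proper_closed_convex f2" and "proper_closed_convex g2"
    and "hoelder_continuous_on (edom f) grad_f1"
    and "hoelder_continuous_on (edom g) grad_g1"
    and "0 < \<mu>" "\<mu> \<le> 1" and "0 < \<nu>" "\<nu> \<le> 1" and "0 \<le> Mf" and "0 \<le> Mg"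
    and "\<And>z w. z \<in> edom f \<Longrightarrow> w \<in> edom f \<Longrightarrow>
           f1 w \<le> f1 z + grad_f1 z \<bullet> (w - z) + Mf / (\<mu> + 1) * norm (w - z) powr (\<mu> + 1)"
    and "\<And>z w. z \<in> edom g \<Longrightarrow> w \<in> edom g \<Longrightarrow>
           g1 w \<le> g1 z + grad_g1 z \<bullet> (w - z) + Mg / (\<nu> + 1) * norm (w - z) powr (\<nu> + 1)"
    and "\<And>v. \<exists>w. is_arg_min (\<lambda>z. ereal (v \<bullet> z) + g2 z) (\<lambda>_. True) w"
  (* CQ *)
    and "c \<in> A ` rel_interior (edom f) + B ` rel_interior (edom g)"
  (* a solution of (P) *)
    and "is_solution f g A B c (xs, ys)"
  (* the algorithm *)
    and "x 0 \<in> edom f" and "y 0 \<in> edom g"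
    and "0 < \<beta> 0" and "0 < H 0" and "0 < \<delta>" and "\<delta> < 1"
    and "\<And>t. R t = A (x t) + B (y t) - c"
    and "\<And>t. is_arg_min
           (\<lambda>z. ereal ((grad_f1 (x t) + \<beta> t *\<^sub>R adjoint A (R t)) \<bullet> (z - x t)
                  + (H t + lambda_max (adjoint A \<circ> A) * \<beta> t) / 2 * (norm (z - x t))\<^sup>2) + f2 z)
           (\<lambda>_. True) (x (Suc t))"
    and "\<And>t. R' t = A (x (Suc t)) + B (y t) - c"
    and "\<And>t. is_arg_min
           (\<lambda>z. ereal ((grad_g1 (y t) + \<beta> t *\<^sub>R adjoint B (R' t)) \<bullet> z) + g2 z)
           (\<lambda>_. True) (u t)"
    and "\<And>t. y (Suc t) = y t + (2 / (real t + 2)) *\<^sub>R (u t - y t)"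
    and "\<And>t. H (Suc t) = max (H 0) (2 * Mf / (\<mu> + 1)) * (real t + 1) powr (1 - \<mu>)"
    and "\<And>t. \<beta> (Suc t) = \<beta> 0 * (real t + 2) powr \<delta>"
  (* membership of d in O(...) with ereal (d t) on the right also says that the gap is finite *)
  shows "(min \<mu> \<nu> \<ge> 1 / 2 \<and> \<delta> = 1 / 2 \<longrightarrow>
            (\<exists>d \<in> O(\<lambda>t. (real t + 1) powr (- (1 / 2))).
               \<forall>t. \<bar>f (x t) + g (y t) - f xs - g ys\<bar> = ereal (d t)) \<and>
            (\<lambda>t. norm (A (x t) + B (y t) - c)) \<in> O(\<lambda>t. (real t + 1) powr (- (1 / 2)))) \<and>
         (min \<mu> \<nu> < 1 / 2 \<and> \<delta> = 1 - min \<mu> \<nu> \<longrightarrow>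
            (\<exists>d \<in> O(\<lambda>t. (real t + 1) powr (- min \<mu> \<nu>)).
               \<forall>t. \<bar>f (x t) + g (y t) - f xs - g ys\<bar> = ereal (d t)) \<and>
            (\<lambda>t. norm (A (x t) + B (y t) - c)) \<in> O(\<lambda>t. (real t + 1) powr (- (1 / 2))))"
proof -
  let ?f2 = "\<lambda>z. real_of_ereal (f2 z)" and ?g2 = "\<lambda>z. real_of_ereal (g2 z)"
  define E where "E t = f1 (x t) + ?f2 (x t) + (g1 (y t) + ?g2 (y t))
    - (f1 xs + ?f2 xs + (g1 ys + ?g2 ys))" for t
  have edom_eq: "edom f = edom f2" "edom g = edom g2"
    using assms(7,8) by (auto simp: edom_def)
  have f: "f z = ereal (f1 z + ?f2 z)" if "z \<in> edom f2" for z
    using proper_closed_convex_finite[OF assms(13) that] assms(7)[of z] by (metis plus_ereal.simps(1))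
  have g: "g z = ereal (g1 z + ?g2 z)" if "z \<in> edom g2" for z
    using proper_closed_convex_finite[OF assms(14) that] assms(8)[of z] by (metis plus_ereal.simps(1))
  have x: "x t \<in> edom f2" for t
    using is_arg_min_edom(1)[OF assms(13) assms(35)] assms(28) edom_eq by (cases t) auto
  have u: "u t \<in> edom g2" for t
    by (rule is_arg_min_edom(1)[OF assms(14) assms(37)])
  have convex_g: "convex (edom g2)"
    using convex_on_imp_convex[OF proper_closed_convex_convex_on[OF assms(14)]] .
  have y: "y t \<in> edom g2" for t
  proof (induction t)
    case 0
    then show ?case using assms(29) edom_eq by simp
  next
    case (Suc t)
    have "y (Suc t) = (1 - 2 / (real t + 2)) *\<^sub>R y t + (2 / (real t + 2)) *\<^sub>R u t"
      unfolding assms(38) by (simp add: algebra_simps)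
    then show ?case using convexD_alt[OF convex_g Suc u[of t], of "2 / (real t + 2)"] by simp
  qed
  have sol_eq: "A xs + B ys = c"
    and opt: "\<And>v w. A v + B w = c \<Longrightarrow> f xs + g ys \<le> f v + g w"
    using assms(27) by (auto simp: is_solution_def is_arg_min_def not_less)
  \<comment> \<open>The constraint qualification supplies a feasible point of finite value. Hence
    the optimal value is finite and the solution lies in both domains.\<close>
  obtain v w where vw: "v \<in> edom f2" "w \<in> edom g2" "A v + B w = c"
  proof -
    from assms(26)[unfolded edom_eq] obtain v w
      where "v \<in> rel_interior (edom f2)" "w \<in> rel_interior (edom g2)" "c = A v + B w"
      by (auto simp: set_plus_def)
    then show thesis using that subsetD[OF rel_interior_subset] by metis
  qed
  have "f xs + g ys < \<infinity>"
    using opt[OF vw(3)] f[OF vw(1)] g[OF vw(2)] by (auto intro: le_less_trans)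
  moreover have "f xs \<noteq> -\<infinity>" "g ys \<noteq> -\<infinity>"
    using assms(3,4) by (auto simp: proper_closed_convex_def)
  ultimately have "xs \<in> edom f" "ys \<in> edom g"
    by (auto simp: edom_def)
  then have sol: "xs \<in> edom f2" "ys \<in> edom g2" by (simp_all add: edom_eq)
  obtain Df where Df: "\<And>v w. v \<in> edom f2 \<Longrightarrow> w \<in> edom f2 \<Longrightarrow> norm (v - w) \<le> Df"
    using dom_diameter_bound[OF assms(5)] unfolding edom_eq by blast
  obtain Dg where Dg: "\<And>v w. v \<in> edom g2 \<Longrightarrow> w \<in> edom g2 \<Longrightarrow> norm (v - w) \<le> Dg"
    using dom_diameter_bound[OF assms(6)] unfolding edom_eq by blast
  have \<beta>: "\<beta> t = \<beta> 0 * (real t + 1) powr \<delta>" for t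
    by (cases t) (simp_all add: assms(40) add_ac)
  have gap: "\<bar>f (x t) + g (y t) - f xs - g ys\<bar> = ereal \<bar>E t\<bar>" for t
    by (simp add: f g x y sol E_def)
  \<comment> \<open>\<open>p\<close> is \<open>1 / 2\<close> in the first case and
    \<open>min \<mu> \<nu>\<close> in the second; both satisfy these conditions, and positivity of
    \<open>p\<close> comes from \<open>\<delta> < 1\<close>.\<close>
  have rates: "(\<exists>d \<in> O(\<lambda>t. (real t + 1) powr (- p)).
        \<forall>t. \<bar>f (x t) + g (y t) - f xs - g ys\<bar> = ereal (d t)) \<and>
      (\<lambda>t. norm (A (x t) + B (y t) - c)) \<in> O(\<lambda>t. (real t + 1) powr (- (1 / 2)))"
    if p: "\<delta> = 1 - p" "p \<le> 1 / 2" "p \<le> \<mu>" "p \<le> \<nu>" for p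
  proof -
    have "0 < p" using assms(33) p(1) by simp
    have "\<exists>C. \<forall>t. \<bar>f1 (x (Suc t)) + ?f2 (x (Suc t)) + (g1 (y (Suc t)) + ?g2 (y (Suc t)))
        - (f1 xs + ?f2 xs + (g1 ys + ?g2 ys))\<bar> \<le> C * (real t + 1) powr (- p)
      \<and> norm (A (x (Suc t)) + B (y (Suc t)) - c) \<le> C * (real t + 1) powr (- (1 / 2))"
    proof (rule conditional_gradient_penalty_rates[OF assms(1,2)
          proper_closed_convex_convex_on[OF assms(13)] proper_closed_convex_convex_on[OF assms(14)]
          assms(9,11,10,12) Df Dg assms(23,24)[unfolded edom_eq] assms(21,22,17-20) p(3,4) \<open>0 < p\<close> p(2)
          assms(26)[unfolded edom_eq] _ sol sol_eq x y u _ _ assms(38,31,39,30) \<beta>[unfolded p(1)]])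
      show "f1 xs + ?f2 xs + (g1 ys + ?g2 ys) \<le> f1 v + ?f2 v + (g1 w + ?g2 w)"
        if "v \<in> edom f2" "w \<in> edom g2" "A v + B w = c" for v w
        using opt[OF that(3)] by (simp add: f g that sol)
    qed (use is_arg_min_edom(2)[OF assms(13) assms(35)] is_arg_min_edom(2)[OF assms(14) assms(37)]
        in \<open>simp_all add: assms(34,36)\<close>)
    then obtain C where C: "\<And>t. \<bar>E (Suc t)\<bar> \<le> C * (real t + 1) powr (- p)"
      "\<And>t. norm (A (x (Suc t)) + B (y (Suc t)) - c) \<le> C * (real t + 1) powr (- (1 / 2))"
      unfolding E_def by blast
    have "(\<lambda>t. \<bar>E t\<bar>) \<in> O(\<lambda>t. (real t + 1) powr (- p))"
      using C(1) \<open>0 < p\<close> p(2) by (intro bigo_powr_minusI[where C = C]) auto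
    moreover have "(\<lambda>t. norm (A (x t) + B (y t) - c)) \<in> O(\<lambda>t. (real t + 1) powr (- (1 / 2)))"
      using C(2) by (intro bigo_powr_minusI[where C = C]) auto
    ultimately show ?thesis using gap by (intro conjI bexI[of _ "\<lambda>t. \<bar>E t\<bar>"]) auto
  qed
  show ?thesis
    using rates[of "1 / 2"] rates[of "min \<mu> \<nu>"] by auto
qed

end
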